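(* Let $m\ge 3$. There does not exist any connected orientable real hypersurface $M$ in the complex hyperbolic two-plane Grassmannian $SU_{2,m}/S(U_2\cdot U_m)$ whose shape operator $A$ is $\mathcal{F}$-invariant, i.e. satisfies $\mathcal{L}_X A=0$ for every vector field $X$ on $M$ belonging to $\mathcal{F}=\mathcal{C}^\perp\cup\mathcal{Q}^\perp$.
   Context: $\bar M=SU_{2,m}/S(U_2\cdot U_m)$ is the Riemannian symmetric space of noncompact type, rank 2 and real dimension $4m$, with its $SU_{2,m}$-invariant metric $g$ (unique up to a constant factor, whose choice is immaterial for the statement). The isotropy algebra splits as $\mathfrak{su}_2\oplus\mathfrak{su}_m\oplus\mathfrak{u}_1$. The center $\mathfrak{u}_1$ induces the Kähler structure $J$ on $\bar M$, and $\mathfrak{su}_2$ induces a quaternionic Kähler structure $\mathfrak{J}$, a parallel rank 3 subbundle of $\mathrm{End}(T\bar M)$ locally spanned by almost Hermitian structures $J_1,J_2,J_3$ with $J_\nu J_{\nu+1}=J_{\nu+2}=-J_{\nu+1}J_\nu$ (indices mod 3); moreover $JJ_\nu=J_\nu J$. A real hypersurface $M$ is a real codimension one submanifold, with induced metric $g$ and unit normal field $N$. The Reeb vector field is $\xi=-JN$, and locally $\xi_\nu=-J_\nu N$ for $\nu=1,2,3$. The shape operator is $AX=-\bar\nabla_X N$, where $\bar\nabla$ is the Levi-Civita connection of $\bar M$. The Lie derivative of $A$ along a (possibly only locally defined) vector field $X$ tangent to $M$ is $(\mathcal{L}_X A)Y=[X,AY]-A[X,Y]$ for $Y$ tangent to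 $M$. $\mathcal{C}=\{X\in TM: JX\in TM\}$ is the maximal complex subbundle of $TM$ and $\mathcal{Q}=\{X\in TM:\mathfrak{J}X\subset TM\}$ is the maximal quaternionic subbundle of $TM$. Their orthogonal complements in $TM$ are $\mathcal{C}^\perp=\mathrm{span}\{\xi\}$ and $\mathcal{Q}^\perp=\mathrm{span}\{\xi_1,\xi_2,\xi_3\}$. A vector field $X$ belongs to $\mathcal{F}=\mathcal{C}^\perp\cup\mathcal{Q}^\perp$ if it is a section of $\mathcal{C}^\perp$ or a section of $\mathcal{Q}^\perp$. *)

theory Defs
  imports "HOL-Analysis.Analysis"
begin

section \<open>Smooth maps and submanifolds of a Euclidean space\<close>

fun Ck_on :: "nat \<Rightarrow> 'a::real_normed_vector set \<Rightarrow> ('a \<Rightarrow> 'b::real_normed_vector) \<Rightarrow> bool" where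
  "Ck_on 0 S f \<longleftrightarrow> continuous_on S f"
| "Ck_on (Suc k) S f \<longleftrightarrow> (\<forall>x\<in>S. f differentiable (at x)) \<and>
     (\<forall>v. Ck_on k S (\<lambda>x. frechet_derivative f (at x) v))"

definition smooth_on :: "'a::real_normed_vector set \<Rightarrow> ('a \<Rightarrow> 'b::real_normed_vector) \<Rightarrow> bool" where
  "smooth_on S f \<longleftrightarrow> open S \<and> (\<forall>k. Ck_on k S f)"

text \<open>Smoothness on an arbitrary subset, in particular on a submanifold: local smooth extendability.\<close>

definition smooth_within :: "'a::real_normed_vector set \<Rightarrow> ('a \<Rightarrow> 'b::real_normed_vector) \<Rightarrow> bool" where
  "smooth_within S f \<longleftrightarrow>
     (\<forall>p\<in>S. \<exists>W F. p \<in> W \<and> smooth_on W F \<and> (\<forall>q\<in>W \<inter> S. F q = f q))"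

text \<open>The derivative of \<open>f\<close> at \<open>p\<close> in direction \<open>v\<close>. If \<open>S\<close> is a submanifold, a derivative of
  \<open>f\<close> at \<open>p\<close> within \<open>S\<close> is not unique as a linear map on the ambient space, but its values on
  vectors \<open>v\<close> tangent to \<open>S\<close> at \<open>p\<close> are. It is only used for such \<open>v\<close>.\<close>

definition dird :: "'a::real_normed_vector set \<Rightarrow> ('a \<Rightarrow> 'b::real_normed_vector) \<Rightarrow> 'a \<Rightarrow> 'a \<Rightarrow> 'b" where
  "dird S f p v = frechet_derivative f (at p within S) v"

definition local_param ::
    "'a::euclidean_space set \<Rightarrow> (real^'k) set \<Rightarrow> (real^'k \<Rightarrow> 'a) \<Rightarrow> bool" where
  "local_param M V \<psi> \<longleftrightarrow> smooth_on V \<psi> \<and>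
     (\<forall>x\<in>V. inj (frechet_derivative \<psi> (at x))) \<and>
     openin (top_of_set M) (\<psi> ` V) \<and> (\<exists>\<theta>. homeomorphism V (\<psi> ` V) \<psi> \<theta>)"

text \<open>Embedded submanifolds of dimension \<open>CARD('k)\<close>; the first argument only carries the type \<open>'k\<close>.\<close>

definition submanifold :: "'k::finite itself \<Rightarrow> 'a::euclidean_space set \<Rightarrow> bool" where
  "submanifold k M \<longleftrightarrow>
     (\<forall>p\<in>M. \<exists>V (\<psi> :: real^'k \<Rightarrow> 'a). local_param M V \<psi> \<and> p \<in> \<psi> ` V)"

text \<open>Existence of an oriented atlas. The linear map \<open>L\<close> below is the derivative at \<open>x\<close> of the
  coordinate change from \<open>\<psi>\<close> to \<open>\<phi>\<close>.\<close>

definition orientable :: "'k::finite itself \<Rightarrow> 'a::euclidean_space set \<Rightarrow> bool" where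
  "orientable k M \<longleftrightarrow>
     (\<exists>\<A> :: ((real^'k) set \<times> (real^'k \<Rightarrow> 'a)) set.
        (\<forall>(V, \<psi>) \<in> \<A>. local_param M V \<psi>) \<and>
        (\<forall>p\<in>M. \<exists>(V, \<psi>) \<in> \<A>. p \<in> \<psi> ` V) \<and>
        (\<forall>(V, \<psi>) \<in> \<A>. \<forall>(W, \<phi>) \<in> \<A>. \<forall>x\<in>V. \<forall>y\<in>W. \<psi> x = \<phi> y \<longrightarrow>
           (\<exists>L. linear L \<and> det (matrix L) > 0 \<and>
              (\<forall>v. frechet_derivative \<phi> (at y) (L v) = frechet_derivative \<psi> (at x) v))))"

definition tangent_space :: "'a::euclidean_space set \<Rightarrow> 'a \<Rightarrow> 'a set" where
  "tangent_space M p =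
     {v. \<exists>(\<epsilon>::real) c. \<epsilon> > 0 \<and> smooth_on {-\<epsilon><..<\<epsilon>} c \<and> c ` {-\<epsilon><..<\<epsilon>} \<subseteq> M \<and>
         c 0 = p \<and> (c has_vector_derivative v) (at 0)}"

text \<open>Vector fields tangent to \<open>M\<close>, defined on a subset \<open>U\<close> of \<open>M\<close>, and their Lie bracket.\<close>

definition vector_field :: "'a::euclidean_space set \<Rightarrow> 'a set \<Rightarrow> ('a \<Rightarrow> 'a) \<Rightarrow> bool" where
  "vector_field M U X \<longleftrightarrow> smooth_within U X \<and> (\<forall>p\<in>U. X p \<in> tangent_space M p)"

definition lie_bracket ::
    "'a::euclidean_space set \<Rightarrow> ('a \<Rightarrow> 'a) \<Rightarrow> ('a \<Rightarrow> 'a) \<Rightarrow> 'a \<Rightarrow> 'a" where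
  "lie_bracket U X Y p = dird U Y p (X p) - dird U X p (Y p)"

section \<open>Hypersurfaces in an open subset of a Euclidean space with a Riemannian metric\<close>

text \<open>A metric \<open>g\<close> is given by its values \<open>g p u v\<close>, where \<open>u\<close> and \<open>v\<close> are tangent vectors at \<open>p\<close>.
  The Christoffel form \<open>\<Gamma>\<^sub>p(u,v)\<close> is the Levi-Civita derivative at \<open>p\<close> of the
  constant vector field \<open>v\<close> in direction \<open>u\<close>; it is determined by the Koszul formula.\<close>

definition christoffel ::
    "('a::euclidean_space \<Rightarrow> 'a \<Rightarrow> 'a \<Rightarrow> real) \<Rightarrow> 'a \<Rightarrow> 'a \<Rightarrow> 'a \<Rightarrow> 'a" where
  "christoffel g p u v = (THE w. \<forall>z. 2 * g p w z =
       frechet_derivative (\<lambda>q. g q v z) (at p) u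
     + frechet_derivative (\<lambda>q. g q u z) (at p) v
     - frechet_derivative (\<lambda>q. g q u v) (at p) z)"

text \<open>The Levi-Civita derivative at \<open>p\<close>, in the tangent direction \<open>u\<close>, of a field \<open>X\<close> along \<open>M\<close>.\<close>

definition levi_civita ::
    "('a::euclidean_space \<Rightarrow> 'a \<Rightarrow> 'a \<Rightarrow> real) \<Rightarrow> 'a set \<Rightarrow> 'a \<Rightarrow> ('a \<Rightarrow> 'a) \<Rightarrow> 'a \<Rightarrow> 'a" where
  "levi_civita g M u X p = dird M X p u + christoffel g p u (X p)"

definition unit_normal_field ::
    "('a::euclidean_space \<Rightarrow> 'a \<Rightarrow> 'a \<Rightarrow> real) \<Rightarrow> 'a set \<Rightarrow> ('a \<Rightarrow> 'a) \<Rightarrow> bool" where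
  "unit_normal_field g M N \<longleftrightarrow> smooth_within M N \<and>
     (\<forall>p\<in>M. g p (N p) (N p) = 1 \<and> (\<forall>v\<in>tangent_space M p. g p (N p) v = 0))"

definition shape_operator ::
    "('a::euclidean_space \<Rightarrow> 'a \<Rightarrow> 'a \<Rightarrow> real) \<Rightarrow> 'a set \<Rightarrow> ('a \<Rightarrow> 'a) \<Rightarrow> 'a \<Rightarrow> 'a \<Rightarrow> 'a" where
  "shape_operator g M N p v = - levi_civita g M v N p"

text \<open>\<open>(\<L>\<^sub>X A) Y = [X, A Y] - A [X, Y]\<close> for vector fields \<open>X\<close>, \<open>Y\<close> on an open
  subset \<open>U\<close> of \<open>M\<close>.\<close>

definition lie_derivative ::
    "'a::euclidean_space set \<Rightarrow> ('a \<Rightarrow> 'a) \<Rightarrow> ('a \<Rightarrow> 'a \<Rightarrow> 'a) \<Rightarrow> ('a \<Rightarrow> 'a) \<Rightarrow> 'a \<Rightarrow> 'a" where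
  "lie_derivative U X A Y p =
     lie_bracket U X (\<lambda>q. A q (Y q)) p - A p (lie_bracket U X Y p)"

section \<open>The complex hyperbolic two-plane Grassmannian\<close>

definition cadjoint :: "complex^'n^'m \<Rightarrow> complex^'m^'n" where
  "cadjoint A = (\<chi> i j. cnj (A $ j $ i))"

definition indef_form :: "complex^(2 + 'm::finite)^(2 + 'm)" where
  "indef_form = (\<chi> i j. if i = j then (case i of Inl _ \<Rightarrow> - 1 | Inr _ \<Rightarrow> 1) else 0)"

definition SU2m :: "(complex^(2 + 'm::finite)^(2 + 'm)) set" where
  "SU2m = {h. cadjoint h ** indef_form ** h = indef_form \<and> det h = 1}"

definition block11 :: "complex^(2 + 'm::finite)^(2 + 'm) \<Rightarrow> complex^2^2" where
  "block11 h = (\<chi> i j. h $ Inl i $ Inl j)"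

definition block12 :: "complex^(2 + 'm::finite)^(2 + 'm) \<Rightarrow> complex^'m^2" where
  "block12 h = (\<chi> i j. h $ Inl i $ Inr j)"

definition block21 :: "complex^(2 + 'm::finite)^(2 + 'm) \<Rightarrow> complex^2^'m" where
  "block21 h = (\<chi> i j. h $ Inr i $ Inl j)"

definition block22 :: "complex^(2 + 'm::finite)^(2 + 'm) \<Rightarrow> complex^'m^'m" where
  "block22 h = (\<chi> i j. h $ Inr i $ Inr j)"

text \<open>A matrix \<open>Z\<close> with \<open>m\<close> rows and 2 columns stands for the 2-plane \<open>{(u, Z u) | u}\<close>. A matrix
  \<open>h\<close> maps it to the 2-plane \<open>{((A + B Z) u, (C + D Z) u) | u}\<close>, where \<open>A, B, C, D\<close> are the
  blocks of \<open>h\<close>.\<close>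

definition act :: "complex^(2 + 'm::finite)^(2 + 'm) \<Rightarrow> complex^2^'m \<Rightarrow> complex^2^'m" where
  "act h Z = (block21 h + block22 h ** Z) ** matrix_inv (block11 h + block12 h ** Z)"

text \<open>The orbit of the origin \<open>Z = 0\<close>. The stabilizer of the origin consists of the block diagonal
  matrices in \<open>SU2m\<close>, i.e. it is \<open>S(U\<^sub>2 U\<^sub>m)\<close>, so that the orbit is
  \<open>SU\<^bsub>2,m\<^esub>/S(U\<^sub>2 U\<^sub>m)\<close>. It is the bounded domain \<open>I - Z\<^sup>* Z > 0\<close>, i.e. the set of
  2-planes on which the Hermitian form is negative definite. As it is an open subset of the space
  of all matrices, its tangent spaces are all identified with that space.\<close>

definition grassmannian :: "(complex^2^'m::finite) set" where
  "grassmannian = {act h 0 | h. h \<in> SU2m}"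

definition act_deriv ::
    "complex^(2 + 'm::finite)^(2 + 'm) \<Rightarrow> complex^2^'m \<Rightarrow> complex^2^'m \<Rightarrow> complex^2^'m" where
  "act_deriv h Z = frechet_derivative (act h) (at Z)"

definition invariant_metric ::
    "(complex^2^'m::finite \<Rightarrow> complex^2^'m \<Rightarrow> complex^2^'m \<Rightarrow> real) \<Rightarrow> bool" where
  "invariant_metric g \<longleftrightarrow>
     (\<forall>Z\<in>grassmannian. bilinear (g Z) \<and> (\<forall>X Y. g Z X Y = g Z Y X) \<and>
        (\<forall>X. X \<noteq> 0 \<longrightarrow> g Z X X > 0)) \<and>
     (\<forall>X Y. smooth_on grassmannian (\<lambda>Z. g Z X Y)) \<and>
     (\<forall>h\<in>SU2m. \<forall>Z\<in>grassmannian. \<forall>X Y.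
        g (act h Z) (act_deriv h Z X) (act_deriv h Z Y) = g Z X Y)"

text \<open>An element \<open>diag(\<alpha>, \<delta>)\<close> of the isotropy algebra acts on the tangent space at the
  origin by \<open>X \<mapsto> \<delta> X - X \<alpha>\<close>, the derivative of \<open>exp(t \<delta>) X exp(-t \<alpha>)\<close>
  at \<open>t = 0\<close>.\<close>

definition isotropy_rep ::
    "complex^2^2 \<Rightarrow> complex^'m^'m \<Rightarrow> complex^2^'m::finite \<Rightarrow> complex^2^'m" where
  "isotropy_rep \<alpha> \<delta> X = \<delta> ** X - X ** \<alpha>"

definition su2 :: "(complex^2^2) set" where
  "su2 = {\<alpha>. cadjoint \<alpha> = - \<alpha> \<and> trace \<alpha> = 0}"

text \<open>The center of the isotropy algebra is spanned by \<open>diag(\<alpha>, \<delta>)\<close> with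
  \<open>\<alpha> = -m/(m+2) \<i> I\<^sub>2\<close> and \<open>\<delta> = 2/(m+2) \<i> I\<^sub>m\<close>, which acts on the tangent space
  at the origin as multiplication by \<open>\<i>\<close>. Since \<open>SU2m\<close> acts by holomorphic maps, the induced
  invariant complex structure is multiplication by \<open>\<i>\<close> at every point.\<close>

definition kaehler_structure :: "complex^2^'m::finite \<Rightarrow> complex^2^'m" where
  "kaehler_structure X = (\<chi> i j. \<i> * X $ i $ j)"

text \<open>The fibre at \<open>Z\<close> of the quaternionic Kaehler structure: the image of \<open>su2\<close> under the isotropy
  representation at the origin, transported to \<open>Z\<close> by the group. The fibre at the origin is
  invariant under the stabilizer, hence each \<open>h\<close> with \<open>act h 0 = Z\<close> gives the same 3-dimensional
  space of endomorphisms.\<close>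

definition quaternionic_structure ::
    "complex^2^'m::finite \<Rightarrow> (complex^2^'m \<Rightarrow> complex^2^'m) set" where
  "quaternionic_structure Z =
     {act_deriv h 0 \<circ> isotropy_rep \<alpha> 0 \<circ> inv (act_deriv h 0) | h \<alpha>.
        h \<in> SU2m \<and> act h 0 = Z \<and> \<alpha> \<in> su2}"

section \<open>Real hypersurfaces in the Grassmannian\<close>

definition real_hypersurface :: "'k::finite itself \<Rightarrow> (complex^2^'m::finite) set \<Rightarrow> bool" where
  "real_hypersurface k M \<longleftrightarrow> M \<noteq> {} \<and> M \<subseteq> grassmannian \<and>
     submanifold k M \<and> CARD('k) + 1 = DIM(complex^2^'m)"

definition max_complex :: "(complex^2^'m::finite) set \<Rightarrow> complex^2^'m \<Rightarrow> (complex^2^'m) set" where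
  "max_complex M p = {v \<in> tangent_space M p. kaehler_structure v \<in> tangent_space M p}"

definition max_quaternionic ::
    "(complex^2^'m::finite) set \<Rightarrow> complex^2^'m \<Rightarrow> (complex^2^'m) set" where
  "max_quaternionic M p =
     {v \<in> tangent_space M p. \<forall>j\<in>quaternionic_structure p. j v \<in> tangent_space M p}"

definition orth_complement ::
    "('a::euclidean_space \<Rightarrow> 'a \<Rightarrow> 'a \<Rightarrow> real) \<Rightarrow> 'a set \<Rightarrow> ('a \<Rightarrow> 'a set) \<Rightarrow> 'a \<Rightarrow> 'a set" where
  "orth_complement g M \<D> p = {v \<in> tangent_space M p. \<forall>w\<in>\<D> p. g p v w = 0}"

definition belongs_to_F ::
    "(complex^2^'m::finite \<Rightarrow> complex^2^'m \<Rightarrow> complex^2^'m \<Rightarrow> real) \<Rightarrow>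
     (complex^2^'m) set \<Rightarrow> (complex^2^'m) set \<Rightarrow> (complex^2^'m \<Rightarrow> complex^2^'m) \<Rightarrow> bool" where
  "belongs_to_F g M U X \<longleftrightarrow>
     (\<forall>p\<in>U. X p \<in> orth_complement g M (max_complex M) p) \<or>
     (\<forall>p\<in>U. X p \<in> orth_complement g M (max_quaternionic M) p)"

text \<open>Vector fields may be defined on an open subset \<open>U\<close> of \<open>M\<close> only.\<close>

definition F_invariant ::
    "(complex^2^'m::finite \<Rightarrow> complex^2^'m \<Rightarrow> complex^2^'m \<Rightarrow> real) \<Rightarrow>
     (complex^2^'m) set \<Rightarrow> (complex^2^'m \<Rightarrow> complex^2^'m \<Rightarrow> complex^2^'m) \<Rightarrow> bool" where
  "F_invariant g M A \<longleftrightarrow>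
     (\<forall>U X. openin (top_of_set M) U \<and> vector_field M U X \<and> belongs_to_F g M U X \<longrightarrow>
        (\<forall>Y. vector_field M U Y \<longrightarrow> (\<forall>p\<in>U. lie_derivative U X A Y p = 0)))"

end

theory Submission
  imports Defs
begin

text \<open>Only sections of \<open>\<C>\<^sup>\<bottom>\<close> are needed. Since \<open>\<L>\<^bsub>fX\<^esub>A\<close> is not tensorial in \<open>X\<close>, comparing
  \<open>\<L>\<^bsub>f\<xi>\<^esub>A = 0\<close> with \<open>\<L>\<^sub>\<xi>A = 0\<close> gives \<open>df(AY) \<xi> = df(Y) A\<xi>\<close> for all functions \<open>f\<close> and tangent \<open>Y\<close>,
  hence \<open>A = \<alpha> I\<close>. For such an umbilical hypersurface the Codazzi equation says that \<open>R(U,W)N\<close> lies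
  in the span of \<open>U\<close> and \<open>W\<close>. An invariant metric is a multiple of the Bergman metric
  \<open>Re tr ((I - Z\<^sup>*Z)\<^sup>-\<^sup>1 X\<^sup>* (I - ZZ\<^sup>*)\<^sup>-\<^sup>1 Y)\<close>, whose curvature is explicit; at the origin and with \<open>U = \<i>W\<close>
  the condition becomes \<open>W W\<^sup>* N + N W\<^sup>* W \<in> \<complex> W\<close>, and it fails for a suitable \<open>W\<close> of rank one.\<close>

section \<open>Calculus of smooth maps\<close>

text \<open>Umbilicity arises pointwise, so the principal curvature \<alpha> comes with no
  regularity; before the Codazzi argument can differentiate it, its differentiability has to be
  recovered from N itself. The Levi-Civita connection enters through a definite description for an
  unspecified invariant metric. The Koszul formula is not solved: an explicit symmetric form
  compatible with the metric is exhibited, and uniqueness identifies the two. The choice U = iW has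
  the following reason. The curvature is R(U,W)N = F(U,W) - F(W,U), where F is complex linear in its
  first and conjugate linear in its second argument. Hence F(iW,W) and F(W,iW) are i F(W,W) and -i
  F(W,W), and the two halves add up to 2i F(W,W) instead of cancelling. At the same time the real
  span of iW and W becomes a complex line, so a single complex proportionality remains to be
  refuted. The hypersurface is never moved to the origin: only vectors at p are pulled back, by the
  derivative of a group element.\<close>

lemma Ck_on_cong:
  assumes "open S" "\<And>x. x \<in> S \<Longrightarrow> f x = g x" "Ck_on k S f"
  shows "Ck_on k S g"
  using assms(2,3)
proof (induction k arbitrary: f g)
  case 0
  then show ?case using continuous_on_cong by force
next
  case (Suc k)
  have eq: "frechet_derivative g (at x) = frechet_derivative f (at x)" "g differentiable (at x)"
    if "x \<in> S" for x
  proof -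
    have "f differentiable (at x)" using Suc.prems(2) that by simp
    then have "(f has_derivative frechet_derivative f (at x)) (at x)"
      by (simp add: frechet_derivative_works)
    then have "(g has_derivative frechet_derivative f (at x)) (at x)"
      using has_derivative_transform_within_open[OF _ assms(1) that] Suc.prems(1) by blast
    then show "frechet_derivative g (at x) = frechet_derivative f (at x)" "g differentiable (at x)"
      using frechet_derivative_at by (metis, auto simp: differentiable_def)
  qed
  have "Ck_on k S (\<lambda>x. frechet_derivative g (at x) v)" for v
    by (rule Suc.IH[of "\<lambda>x. frechet_derivative f (at x) v"]) (use eq Suc.prems in auto)
  then show ?case using eq by simp
qed

lemma Ck_on_mono: "Ck_on k S f \<Longrightarrow> T \<subseteq> S \<Longrightarrow> Ck_on k T f"
proof (induction k arbitrary: f)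
  case 0 then show ?case using continuous_on_subset by auto
next
  case (Suc k) then show ?case by auto
qed

lemma Ck_on_SucD: "Ck_on (Suc k) S f \<Longrightarrow> Ck_on k S f"
proof (induction k arbitrary: f)
  case 0
  then show ?case
    by (auto intro!: continuous_at_imp_continuous_on differentiable_imp_continuous_within)
next
  case (Suc k)
  then show ?case by simp
qed

lemma Ck_on_const: "Ck_on k S (\<lambda>x. c)"
  by (induction k arbitrary: c) auto

text \<open>Uniqueness of the derivative on an open set allows any explicit derivative
  \<open>f'\<close> in place of the \<open>frechet_derivative\<close> of the recursion; the closure
  properties below are proved through this rule.\<close>

lemma Ck_on_SucI:
  assumes "\<And>x. x \<in> S \<Longrightarrow> (f has_derivative f' x) (at x)" "open S"
    and "\<And>v. Ck_on k S (\<lambda>x. f' x v)"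
  shows "Ck_on (Suc k) S f"
proof -
  have fd: "frechet_derivative f (at x) = f' x" if "x \<in> S" for x
    using assms(1)[OF that] frechet_derivative_at by metis
  have "Ck_on k S (\<lambda>x. frechet_derivative f (at x) v)" for v
    by (rule Ck_on_cong[OF assms(2) _ assms(3)[of v]]) (simp add: fd)
  then show ?thesis using assms(1) by (auto simp: differentiable_def)
qed

lemma Ck_on_Suc_has_derivative:
  assumes "Ck_on (Suc k) S f" "x \<in> S"
  shows "(f has_derivative frechet_derivative f (at x)) (at x)"
  using assms frechet_derivative_works by auto

lemma Ck_on_bounded_linear:
  assumes "bounded_linear L" "open S" "Ck_on k S f"
  shows "Ck_on k S (\<lambda>x. L (f x))"
  using assms(3)
proof (induction k arbitrary: f)
  case 0
  then show ?case using bounded_linear.continuous_on[OF assms(1)] by simp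
next
  case (Suc k)
  show ?case
    by (rule Ck_on_SucI[where f'="\<lambda>x v. L (frechet_derivative f (at x) v)"])
      (use Suc assms in \<open>auto intro: bounded_linear.has_derivative[OF assms(1)]
          simp: frechet_derivative_works\<close>)
qed

lemma Ck_on_ident: "open S \<Longrightarrow> Ck_on k S (\<lambda>x. x)"
  by (cases k) (auto intro: Ck_on_const)

lemma Ck_on_add:
  assumes "open S" "Ck_on k S f" "Ck_on k S g"
  shows "Ck_on k S (\<lambda>x. f x + g x)"
  using assms(2,3)
proof (induction k arbitrary: f g)
  case 0
  then show ?case by (simp add: continuous_on_add)
next
  case (Suc k)
  show ?case
    by (rule Ck_on_SucI[where f'="\<lambda>x v. frechet_derivative f (at x) v + frechet_derivative g (at x) v"])
      (use Suc assms in \<open>auto intro!: has_derivative_add simp: frechet_derivative_works[symmetric]\<close>)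
qed

lemma Ck_on_sum:
  assumes "open S" "\<And>i. i \<in> I \<Longrightarrow> Ck_on k S (f i)"
  shows "Ck_on k S (\<lambda>x. \<Sum>i\<in>I. f i x)"
  using assms(2)
proof (induction I rule: infinite_finite_induct)
  case (insert i I)
  then show ?case using Ck_on_add[OF assms(1), of k "f i" "\<lambda>x. \<Sum>i\<in>I. f i x"] by simp
qed (auto simp: Ck_on_const)

lemma Ck_on_bounded_bilinear:
  assumes "bounded_bilinear bop" "open S" "Ck_on k S f" "Ck_on k S g"
  shows "Ck_on k S (\<lambda>x. bop (f x) (g x))"
  using assms(3,4)
proof (induction k arbitrary: f g)
  case 0
  then show ?case using bounded_bilinear.continuous_on[OF assms(1)] by simp
next
  case (Suc k)
  show ?case
  proof (rule Ck_on_SucI[where f'="\<lambda>x v. bop (f x) (frechet_derivative g (at x) v)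
      + bop (frechet_derivative f (at x) v) (g x)"])
    fix v
    show "Ck_on k S (\<lambda>x. bop (f x) (frechet_derivative g (at x) v)
        + bop (frechet_derivative f (at x) v) (g x))"
    proof (rule Ck_on_add[OF assms(2)])
      show "Ck_on k S (\<lambda>x. bop (f x) (frechet_derivative g (at x) v))"
        by (rule Suc.IH[OF Ck_on_SucD[OF Suc.prems(1)]]) (use Suc.prems in simp)
      show "Ck_on k S (\<lambda>x. bop (frechet_derivative f (at x) v) (g x))"
        by (rule Suc.IH[OF _ Ck_on_SucD[OF Suc.prems(2)]]) (use Suc.prems in simp)
    qed
  next
    fix x assume x: "x \<in> S"
    show "((\<lambda>x. bop (f x) (g x)) has_derivative (\<lambda>v. bop (f x) (frechet_derivative g (at x) v)
      + bop (frechet_derivative f (at x) v) (g x))) (at x)"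
      by (rule bounded_bilinear.FDERIV[OF assms(1) Ck_on_Suc_has_derivative[OF Suc.prems(1) x]
            Ck_on_Suc_has_derivative[OF Suc.prems(2) x]])
  qed (rule assms(2))
qed

lemma Ck_on_compose:
  fixes f :: "'a::real_normed_vector \<Rightarrow> 'b::euclidean_space"
  assumes "open S" "open T" "f ` S \<subseteq> T" "Ck_on k S f" "Ck_on k T g"
  shows "Ck_on k S (\<lambda>x. g (f x))"
  using assms(4,5)
proof (induction k arbitrary: g)
  case 0
  then show ?case using assms(3) continuous_on_compose2[of T g S f] by simp
next
  case (Suc k)
  \<comment> \<open>In the chain rule the direction fed to the derivative of g varies with x, while
    the induction hypothesis covers only fixed directions. Expansion in the basis leaves products of
    coordinates with derivatives in fixed directions.\<close>
  have dg: "frechet_derivative g (at (f x)) w =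
      (\<Sum>b\<in>Basis. (w \<bullet> b) *\<^sub>R frechet_derivative g (at (f x)) b)" if "x \<in> S" for x w
  proof -
    have "linear (frechet_derivative g (at (f x)))"
      using Suc.prems(2) that assms(3) by (auto intro!: linear_frechet_derivative)
    then have "frechet_derivative g (at (f x)) (\<Sum>b\<in>Basis. (w \<bullet> b) *\<^sub>R b)
        = (\<Sum>b\<in>Basis. (w \<bullet> b) *\<^sub>R frechet_derivative g (at (f x)) b)"
      by (simp add: linear_sum linear_cmul)
    then show ?thesis by (simp add: euclidean_representation)
  qed
  show ?case
  proof (rule Ck_on_SucI[where f'="\<lambda>x v. \<Sum>b\<in>Basis. (frechet_derivative f (at x) v \<bullet> b) *\<^sub>R
      frechet_derivative g (at (f x)) b"])
    fix x assume x: "x \<in> S"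
    then have "((\<lambda>x. g (f x)) has_derivative
        (\<lambda>v. frechet_derivative g (at (f x)) (frechet_derivative f (at x) v))) (at x)"
      using assms(3) has_derivative_compose[OF Ck_on_Suc_has_derivative[OF Suc.prems(1) x]
          Ck_on_Suc_has_derivative[OF Suc.prems(2)]] by blast
    then show "((\<lambda>x. g (f x)) has_derivative (\<lambda>v. \<Sum>b\<in>Basis.
        (frechet_derivative f (at x) v \<bullet> b) *\<^sub>R frechet_derivative g (at (f x)) b)) (at x)"
      by (simp only: dg[OF x, symmetric])
  next
    fix v
    show "Ck_on k S (\<lambda>x. \<Sum>b\<in>Basis. (frechet_derivative f (at x) v \<bullet> b) *\<^sub>R
        frechet_derivative g (at (f x)) b)"
    proof (rule Ck_on_sum[OF assms(1)], rule Ck_on_bounded_bilinear[OF bounded_bilinear_scaleR assms(1)])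
      fix b :: 'b
      show "Ck_on k S (\<lambda>x. frechet_derivative f (at x) v \<bullet> b)"
        by (rule Ck_on_bounded_linear[OF bounded_linear_inner_left assms(1)]) (use Suc.prems in simp)
      show "Ck_on k S (\<lambda>x. frechet_derivative g (at (f x)) b)"
        by (rule Suc.IH[OF Ck_on_SucD[OF Suc.prems(1)]]) (use Suc.prems in simp)
    qed
  qed (rule assms(1))
qed

section \<open>Symmetry of second derivatives\<close>

lemma second_difference_eq:
  fixes f :: "'a::real_normed_vector \<Rightarrow> real"
  assumes h: "0 < h" and sub: "\<And>s t. 0 \<le> s \<Longrightarrow> s \<le> h \<Longrightarrow> 0 \<le> t \<Longrightarrow> t \<le> h \<Longrightarrow> x + s *\<^sub>R u + t *\<^sub>R w \<in> S"
    and f: "Ck_on 2 S f"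
  obtains s t where "0 < s" "s < h" "0 < t" "t < h"
    "f (x + h *\<^sub>R u + h *\<^sub>R w) - f (x + h *\<^sub>R u) - f (x + h *\<^sub>R w) + f x =
      h\<^sup>2 * frechet_derivative (\<lambda>y. frechet_derivative f (at y) u) (at (x + s *\<^sub>R u + t *\<^sub>R w)) w"
proof -
  let ?G = "\<lambda>y. frechet_derivative f (at y) u"
  have df: "(f has_derivative frechet_derivative f (at y)) (at y)"
    and dG: "(?G has_derivative frechet_derivative ?G (at y)) (at y)" if "y \<in> S" for y
    using f that by (auto simp: numeral_2_eq_2 frechet_derivative_works[symmetric])
  have lin: "frechet_derivative f (at y) (r *\<^sub>R v) = r *\<^sub>R frechet_derivative f (at y) v"
    "frechet_derivative ?G (at y) (r *\<^sub>R v) = r *\<^sub>R frechet_derivative ?G (at y) v" if "y \<in> S" for y r v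
    using has_derivative_linear[OF df[OF that]] has_derivative_linear[OF dG[OF that]]
    by (auto simp: linear_cmul)
  \<comment> \<open>The second difference is \<open>\<phi> h - \<phi> 0\<close>. The mean value
    theorem in s produces a difference of derivatives along u; a second application, in t, produces
    the mixed derivative.\<close>
  define \<phi> where "\<phi> = (\<lambda>s. f (x + s *\<^sub>R u + h *\<^sub>R w) - f (x + s *\<^sub>R u))"
  have d1: "((\<lambda>s. f (x + s *\<^sub>R u + t *\<^sub>R w)) has_real_derivative ?G (x + s *\<^sub>R u + t *\<^sub>R w)) (at s)"
    if "0 \<le> s" "s \<le> h" "0 \<le> t" "t \<le> h" for s t
  proof -
    have "((\<lambda>s. x + s *\<^sub>R u + t *\<^sub>R w) has_derivative (\<lambda>r. r *\<^sub>R u)) (at s)"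
      by (auto intro!: derivative_eq_intros)
    from has_derivative_compose[OF this df[OF sub[OF that]]]
    show ?thesis unfolding has_field_derivative_def
      by (rule has_derivative_eq_rhs) (auto simp: lin sub that)
  qed
  have "(\<phi> has_real_derivative ?G (x + s *\<^sub>R u + h *\<^sub>R w) - ?G (x + s *\<^sub>R u)) (at s)"
    if "0 \<le> s" "s \<le> h" for s
    unfolding \<phi>_def using d1[of s h] d1[of s 0] that h by (auto intro!: DERIV_diff)
  then obtain s where s: "0 < s" "s < h"
    "\<phi> h - \<phi> 0 = (h - 0) * (?G (x + s *\<^sub>R u + h *\<^sub>R w) - ?G (x + s *\<^sub>R u))"
    using MVT2[OF h, of \<phi> "\<lambda>s. ?G (x + s *\<^sub>R u + h *\<^sub>R w) - ?G (x + s *\<^sub>R u)"] by blast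
  have d2: "((\<lambda>t. ?G (x + s *\<^sub>R u + t *\<^sub>R w)) has_real_derivative
      frechet_derivative ?G (at (x + s *\<^sub>R u + t *\<^sub>R w)) w) (at t)" if "0 \<le> t" "t \<le> h" for t
  proof -
    have y: "x + s *\<^sub>R u + t *\<^sub>R w \<in> S" using sub s that by simp
    have "((\<lambda>t. x + s *\<^sub>R u + t *\<^sub>R w) has_derivative (\<lambda>r. r *\<^sub>R w)) (at t)"
      by (auto intro!: derivative_eq_intros)
    from has_derivative_compose[OF this dG[OF y]]
    show ?thesis unfolding has_field_derivative_def
      by (rule has_derivative_eq_rhs) (auto simp: lin y)
  qed
  then obtain t where t: "0 < t" "t < h" "?G (x + s *\<^sub>R u + h *\<^sub>R w) - ?G (x + s *\<^sub>R u + 0 *\<^sub>R w) =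
     (h - 0) * frechet_derivative ?G (at (x + s *\<^sub>R u + t *\<^sub>R w)) w"
    using MVT2[OF h, of "\<lambda>t. ?G (x + s *\<^sub>R u + t *\<^sub>R w)"
        "\<lambda>t. frechet_derivative ?G (at (x + s *\<^sub>R u + t *\<^sub>R w)) w"] by blast
  show thesis
    by (rule that[OF s(1,2) t(1,2)]) (use s(3) t(3) in \<open>simp add: \<phi>_def power2_eq_square algebra_simps\<close>)
qed

text \<open>The second difference quotient is symmetric in u and w. By
  \<open>second_difference_eq\<close> it is a value of either mixed derivative at some point near x,
  and continuity makes both mixed derivatives its limit.\<close>

lemma second_derivative_symmetric_real:
  fixes f :: "'a::real_normed_vector \<Rightarrow> real"
  assumes S: "open S" "x \<in> S" and f: "Ck_on 2 S f"
  shows "frechet_derivative (\<lambda>y. frechet_derivative f (at y) u) (at x) w =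
         frechet_derivative (\<lambda>y. frechet_derivative f (at y) w) (at x) u"
proof -
  define D where "D u w = (\<lambda>y. frechet_derivative (\<lambda>y. frechet_derivative f (at y) u) (at y) w)" for u w
  have cont: "isCont (D u w) x" for u w
    using f S unfolding D_def by (auto simp: numeral_2_eq_2 continuous_on_eq_continuous_at)
  have near: "\<exists>d>0. \<forall>h. 0 < h \<longrightarrow> h < d \<longrightarrow> (\<exists>s t. 0 < s \<and> s < h \<and> 0 < t \<and> t < h \<and>
      f (x + h *\<^sub>R u + h *\<^sub>R w) - f (x + h *\<^sub>R u) - f (x + h *\<^sub>R w) + f x =
      h\<^sup>2 * D u w (x + s *\<^sub>R u + t *\<^sub>R w))" for u w
  proof -
    obtain e where e: "e > 0" "ball x e \<subseteq> S" using S open_contains_ball by blast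
    \<comment> \<open>For h below this bound the parallelogram at x with sides hu and hw stays in
      the ball of radius e; the summand 1 covers u = w = 0.\<close>
    define d where "d = e / (norm u + norm w + 1)"
    have d: "d > 0" using e by (simp add: d_def add_nonneg_pos)
    have sub: "x + s *\<^sub>R u + t *\<^sub>R w \<in> S" if "0 \<le> s" "s \<le> h" "0 \<le> t" "t \<le> h" "h < d" "0 < h" for s t h
    proof -
      have "norm (s *\<^sub>R u + t *\<^sub>R w) \<le> s * norm u + t * norm w"
        using norm_triangle_ineq[of "s *\<^sub>R u" "t *\<^sub>R w"] that by simp
      also have "\<dots> \<le> h * norm u + h * norm w" using that by (intro add_mono mult_right_mono) auto
      also have "\<dots> \<le> h * (norm u + norm w + 1)" using that by (simp add: algebra_simps)
      also have "\<dots> < d * (norm u + norm w + 1)" using that by (intro mult_strict_right_mono) (auto simp: add_nonneg_pos)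
      also have "\<dots> = e" using norm_ge_zero[of u] norm_ge_zero[of w] unfolding d_def by (simp add: add_nonneg_eq_0_iff)
      finally have "x + (s *\<^sub>R u + t *\<^sub>R w) \<in> ball x e"
        by (metis add_diff_cancel_left' dist_commute dist_norm mem_ball)
      then show ?thesis using e by (auto simp: add.assoc)
    qed
    show ?thesis
    proof (rule exI[of _ d], intro conjI d allI impI)
      fix h assume h: "0 < h" "h < d"
      obtain s t where "0 < s" "s < h" "0 < t" "t < h"
        "f (x + h *\<^sub>R u + h *\<^sub>R w) - f (x + h *\<^sub>R u) - f (x + h *\<^sub>R w) + f x =
          h\<^sup>2 * frechet_derivative (\<lambda>y. frechet_derivative f (at y) u) (at (x + s *\<^sub>R u + t *\<^sub>R w)) w"
        by (rule second_difference_eq[where x=x and u=u and w=w, OF h(1) _ f]) (use sub h in auto)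
      then show "\<exists>s t. 0 < s \<and> s < h \<and> 0 < t \<and> t < h \<and>
        f (x + h *\<^sub>R u + h *\<^sub>R w) - f (x + h *\<^sub>R u) - f (x + h *\<^sub>R w) + f x =
        h\<^sup>2 * D u w (x + s *\<^sub>R u + t *\<^sub>R w)" unfolding D_def by blast
    qed
  qed
  define \<Delta> where "\<Delta> h = (f (x + h *\<^sub>R u + h *\<^sub>R w) - f (x + h *\<^sub>R u) - f (x + h *\<^sub>R w) + f x) / h\<^sup>2" for h
  have lim: "((\<lambda>h. (f (x + h *\<^sub>R u + h *\<^sub>R w) - f (x + h *\<^sub>R u) - f (x + h *\<^sub>R w) + f x) / h\<^sup>2)
      \<longlongrightarrow> D u w x) (at_right 0)" for u w
  proof -
    obtain d where d: "d > 0" "\<forall>h. 0 < h \<longrightarrow> h < d \<longrightarrow> (\<exists>s t. 0 < s \<and> s < h \<and> 0 < t \<and> t < h \<and>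
      f (x + h *\<^sub>R u + h *\<^sub>R w) - f (x + h *\<^sub>R u) - f (x + h *\<^sub>R w) + f x =
      h\<^sup>2 * D u w (x + s *\<^sub>R u + t *\<^sub>R w))" using near by blast
    then obtain s t where st: "\<And>h. 0 < h \<Longrightarrow> h < d \<Longrightarrow> 0 < s h \<and> s h < h \<and> 0 < t h \<and> t h < h \<and>
      f (x + h *\<^sub>R u + h *\<^sub>R w) - f (x + h *\<^sub>R u) - f (x + h *\<^sub>R w) + f x =
      h\<^sup>2 * D u w (x + s h *\<^sub>R u + t h *\<^sub>R w)" by metis
    have ev: "eventually (\<lambda>h. 0 < h \<and> h < d) (at_right (0::real))"
      using d(1) eventually_at_right_field by blast
    have id: "((\<lambda>h. h) \<longlongrightarrow> 0) (at_right (0::real))" by (rule tendsto_ident_at)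
    have s0: "(s \<longlongrightarrow> 0) (at_right 0)" "(t \<longlongrightarrow> 0) (at_right 0)"
      by (rule tendsto_sandwich[OF _ _ tendsto_const id]; rule eventually_mono[OF ev]; use st in force)+
    have "((\<lambda>h. x + s h *\<^sub>R u + t h *\<^sub>R w) \<longlongrightarrow> x + 0 *\<^sub>R u + 0 *\<^sub>R w) (at_right 0)"
      by (intro tendsto_intros s0)
    then have "((\<lambda>h. D u w (x + s h *\<^sub>R u + t h *\<^sub>R w)) \<longlongrightarrow> D u w x) (at_right 0)"
      using isCont_tendsto_compose[OF cont] by simp
    then show ?thesis
      by (rule Lim_transform_eventually) (rule eventually_mono[OF ev], use st in auto)
  qed
  have "(\<Delta> \<longlongrightarrow> D u w x) (at_right 0)" using lim[of u w] unfolding \<Delta>_def .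
  moreover have "(\<Delta> \<longlongrightarrow> D w u x) (at_right 0)"
    using lim[of w u] unfolding \<Delta>_def by (simp add: algebra_simps)
  ultimately have "D u w x = D w u x" using tendsto_unique trivial_limit_at_right_real by blast
  then show ?thesis unfolding D_def .
qed

lemma frechet_derivative_bounded_linear:
  assumes "bounded_linear L" "f differentiable (at x)"
  shows "frechet_derivative (\<lambda>x. L (f x)) (at x) v = L (frechet_derivative f (at x) v)"
proof -
  have "((\<lambda>x. L (f x)) has_derivative (\<lambda>v. L (frechet_derivative f (at x) v))) (at x)"
    using assms bounded_linear.has_derivative frechet_derivative_works by blast
  then show ?thesis using frechet_derivative_at by metis
qed

lemma second_derivative_symmetric:
  fixes f :: "'a::real_normed_vector \<Rightarrow> 'b::euclidean_space"
  assumes S: "open S" "x \<in> S" and f: "Ck_on 2 S f"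
  shows "frechet_derivative (\<lambda>y. frechet_derivative f (at y) u) (at x) w =
         frechet_derivative (\<lambda>y. frechet_derivative f (at y) w) (at x) u"
proof (rule euclidean_eqI)
  fix b :: 'b assume "b \<in> Basis"
  let ?L = "\<lambda>z::'b. z \<bullet> b"
  have L: "bounded_linear ?L" by (rule bounded_linear_inner_left)
  have eq: "frechet_derivative (\<lambda>y. frechet_derivative (\<lambda>x. ?L (f x)) (at y) u) (at x) w
      = ?L (frechet_derivative (\<lambda>y. frechet_derivative f (at y) u) (at x) w)" for u w
  proof -
    have *: "frechet_derivative (\<lambda>x. ?L (f x)) (at y) u = ?L (frechet_derivative f (at y) u)"
      if "y \<in> S" for y
      by (rule frechet_derivative_bounded_linear[OF L]) (use f that in \<open>auto simp: numeral_2_eq_2\<close>)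
    have d: "(\<lambda>y. frechet_derivative f (at y) u) differentiable (at x)"
      using f S by (auto simp: numeral_2_eq_2)
    then have "((\<lambda>y. ?L (frechet_derivative f (at y) u)) has_derivative
        (\<lambda>w. ?L (frechet_derivative (\<lambda>y. frechet_derivative f (at y) u) (at x) w))) (at x)"
      using bounded_linear.has_derivative[OF L] frechet_derivative_works by blast
    then have "((\<lambda>y. frechet_derivative (\<lambda>x. ?L (f x)) (at y) u) has_derivative
        (\<lambda>w. ?L (frechet_derivative (\<lambda>y. frechet_derivative f (at y) u) (at x) w))) (at x)"
      by (rule has_derivative_transform_within_open[OF _ S]) (simp add: *)
    then show ?thesis using frechet_derivative_at by metis
  qed
  have "Ck_on 2 S (\<lambda>x. ?L (f x))" by (rule Ck_on_bounded_linear[OF L S(1) f])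
  from second_derivative_symmetric_real[OF S this, of u w]
  show "frechet_derivative (\<lambda>y. frechet_derivative f (at y) u) (at x) w \<bullet> b =
    frechet_derivative (\<lambda>y. frechet_derivative f (at y) w) (at x) u \<bullet> b"
    by (simp only: eq)
qed

section \<open>Functions on subsets that extend smoothly near each point\<close>

lemma smooth_on_imp_smooth_within: "smooth_on W F \<Longrightarrow> S \<subseteq> W \<Longrightarrow> smooth_within S F"
  unfolding smooth_within_def by blast

lemma smooth_on_subset: "smooth_on W F \<Longrightarrow> open V \<Longrightarrow> V \<subseteq> W \<Longrightarrow> smooth_on V F"
  unfolding smooth_on_def using Ck_on_mono by blast

lemma smooth_on_bounded_linear:
  assumes "bounded_linear L" "smooth_on W F"
  shows "smooth_on W (\<lambda>x. L (F x))"
  using assms Ck_on_bounded_linear[OF assms(1), of W] unfolding smooth_on_def by meson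

lemma smooth_on_bounded_bilinear:
  assumes "bounded_bilinear bop" "smooth_on W F" "smooth_on W G"
  shows "smooth_on W (\<lambda>x. bop (F x) (G x))"
  using assms Ck_on_bounded_bilinear[OF assms(1), of W] unfolding smooth_on_def by meson

lemma smooth_on_add: "smooth_on W F \<Longrightarrow> smooth_on W G \<Longrightarrow> smooth_on W (\<lambda>x. F x + G x)"
  by (simp add: smooth_on_def Ck_on_add)

lemma smooth_within_const: "smooth_within S (\<lambda>x. c)"
  by (rule smooth_on_imp_smooth_within[of UNIV]) (auto simp: smooth_on_def Ck_on_const)

lemma smooth_within_ident: "smooth_within S (\<lambda>x. x)"
  by (rule smooth_on_imp_smooth_within[of UNIV]) (auto simp: smooth_on_def Ck_on_ident)

lemma smooth_within_bounded_linear: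
  assumes "bounded_linear L" "smooth_within S f"
  shows "smooth_within S (\<lambda>x. L (f x))"
  unfolding smooth_within_def
proof
  fix p assume "p \<in> S"
  then obtain W F where "p \<in> W" "smooth_on W F" "\<forall>q\<in>W \<inter> S. F q = f q"
    using assms(2) unfolding smooth_within_def by blast
  then show "\<exists>W F. p \<in> W \<and> smooth_on W F \<and> (\<forall>q\<in>W \<inter> S. F q = L (f q))"
    by (intro exI[of _ W] exI[of _ "\<lambda>x. L (F x)"]) (auto intro: smooth_on_bounded_linear assms(1))
qed

lemma smooth_within_pair:
  assumes "smooth_within S f" "smooth_within S g" "p \<in> S"
  obtains W F G where "p \<in> W" "smooth_on W F" "smooth_on W G"
    "\<forall>q\<in>W \<inter> S. F q = f q" "\<forall>q\<in>W \<inter> S. G q = g q"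
proof -
  obtain W F where W: "p \<in> W" "smooth_on W F" "\<forall>q\<in>W \<inter> S. F q = f q"
    using assms(1,3) unfolding smooth_within_def by blast
  obtain V G where V: "p \<in> V" "smooth_on V G" "\<forall>q\<in>V \<inter> S. G q = g q"
    using assms(2,3) unfolding smooth_within_def by blast
  have o: "open (W \<inter> V)" using W V by (auto simp: smooth_on_def)
  show thesis
    using W V smooth_on_subset[OF W(2) o] smooth_on_subset[OF V(2) o]
    by (intro that[of "W \<inter> V" F G]) auto
qed

lemma smooth_within_bounded_bilinear:
  assumes "bounded_bilinear bop" "smooth_within S f" "smooth_within S g"
  shows "smooth_within S (\<lambda>x. bop (f x) (g x))"
  unfolding smooth_within_def
proof
  fix p assume "p \<in> S"
  then obtain W F G where "p \<in> W" "smooth_on W F" "smooth_on W G"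
    "\<forall>q\<in>W \<inter> S. F q = f q" "\<forall>q\<in>W \<inter> S. G q = g q"
    using smooth_within_pair[OF assms(2,3)] by blast
  then show "\<exists>W F. p \<in> W \<and> smooth_on W F \<and> (\<forall>q\<in>W \<inter> S. F q = bop (f q) (g q))"
    by (intro exI[of _ W] exI[of _ "\<lambda>x. bop (F x) (G x)"])
      (auto intro: smooth_on_bounded_bilinear assms(1))
qed

lemma smooth_within_add:
  assumes "smooth_within S f" "smooth_within S g"
  shows "smooth_within S (\<lambda>x. f x + g x)"
  unfolding smooth_within_def
proof
  fix p assume "p \<in> S"
  then obtain W F G where "p \<in> W" "smooth_on W F" "smooth_on W G"
    "\<forall>q\<in>W \<inter> S. F q = f q" "\<forall>q\<in>W \<inter> S. G q = g q"
    using smooth_within_pair[OF assms] by blast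
  then show "\<exists>W F. p \<in> W \<and> smooth_on W F \<and> (\<forall>q\<in>W \<inter> S. F q = f q + g q)"
    by (intro exI[of _ W] exI[of _ "\<lambda>x. F x + G x"]) (auto intro: smooth_on_add)
qed

lemma smooth_within_sum:
  assumes "\<And>i. i \<in> I \<Longrightarrow> smooth_within S (f i)"
  shows "smooth_within S (\<lambda>x. \<Sum>i\<in>I. f i x)"
  using assms
  by (induction I rule: infinite_finite_induct) (auto intro: smooth_within_const smooth_within_add)

lemma smooth_within_differentiable:
  assumes "smooth_within S f" "p \<in> S"
  shows "f differentiable (at p within S)"
proof -
  obtain W F where W: "p \<in> W" "smooth_on W F" "\<forall>q\<in>W \<inter> S. F q = f q"
    using assms unfolding smooth_within_def by blast
  then have "open W" "Ck_on (Suc 0) W F" unfolding smooth_on_def by blast+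
  then have "(F has_derivative frechet_derivative F (at p)) (at p within S)"
    using W(1) Ck_on_Suc_has_derivative has_derivative_at_withinI by blast
  moreover obtain e where "e > 0" "ball p e \<subseteq> W"
    using \<open>open W\<close> W(1) open_contains_ball by blast
  ultimately have "(f has_derivative frechet_derivative F (at p)) (at p within S)"
    using W(3) assms(2) by (elim has_derivative_transform_within[where d=e]) (auto simp: dist_commute subset_eq)
  then show ?thesis by (auto simp: differentiable_def)
qed

section \<open>Derivatives along submanifolds\<close>

text \<open>Composition with a curve in M of velocity v turns both derivatives into the derivative
  of one function of a real variable, which is unique.\<close>

lemma tangent_derivative_unique:
  assumes v: "v \<in> tangent_space M p" and U: "openin (top_of_set M) U" "p \<in> U"
    and D: "(Y has_derivative D1) (at p within U)" "(Y has_derivative D2) (at p within U)"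
  shows "D1 v = D2 v"
proof -
  obtain \<epsilon> c where c: "\<epsilon> > 0" "smooth_on {-\<epsilon><..<\<epsilon>} c" "c ` {-\<epsilon><..<\<epsilon>} \<subseteq> M" "c 0 = p"
    "(c has_vector_derivative v) (at 0)" using v unfolding tangent_space_def by blast
  obtain T where T: "open T" "U = M \<inter> T" using U(1) by (meson openin_open)
  have "isCont c 0" using c(5) has_vector_derivative_continuous by blast
  then have "eventually (\<lambda>t. c t \<in> T) (at 0)"
    using T U(2) c(4) unfolding isCont_def by (intro topological_tendstoD[of c p]) auto
  then obtain d where d: "d > 0" "\<And>t. t \<noteq> 0 \<Longrightarrow> dist t 0 < d \<Longrightarrow> c t \<in> T"
    by (auto simp: eventually_at)
  \<comment> \<open>The curve is known to lie in M; on this smaller interval it also stays in the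
    relatively open set U.\<close>
  define I where "I = {- min d \<epsilon> <..< min d \<epsilon>}"
  have I: "open I" "0 \<in> I" using d(1) c(1) by (auto simp: I_def)
  have cI: "c ` I \<subseteq> U"
  proof
    fix y assume "y \<in> c ` I"
    then obtain t where t: "t \<in> I" "y = c t" by blast
    then have "c t \<in> M" using c(3) by (auto simp: I_def)
    moreover have "c t \<in> T"
      by (cases "t = 0") (use t d(2)[of t] c(4) U(2) T(2) in \<open>auto simp: I_def dist_real_def\<close>)
    ultimately show "y \<in> U" using t T by blast
  qed
  have "((\<lambda>t. Y (c t)) has_vector_derivative D v) (at 0)"
    if "(Y has_derivative D) (at p within U)" for D
  proof -
    have "(c has_derivative (\<lambda>t. t *\<^sub>R v)) (at 0 within I)"
      using c(5) has_derivative_at_withinI unfolding has_vector_derivative_def by blast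
    moreover have "(Y has_derivative D) (at (c 0) within c ` I)"
      using has_derivative_subset[OF that cI] c(4) by simp
    ultimately have "((\<lambda>t. Y (c t)) has_derivative (\<lambda>t. D (t *\<^sub>R v))) (at 0 within I)"
      by (rule has_derivative_in_compose)
    then show ?thesis
      unfolding has_vector_derivative_def at_within_open[OF I(2,1)]
      by (rule has_derivative_eq_rhs) (simp add: linear_cmul[OF has_derivative_linear[OF that]])
  qed
  then show ?thesis using D vector_derivative_unique_at by blast
qed

text \<open>This makes \<open>dird\<close> computable: it evaluates an arbitrarily chosen
  derivative, but on tangent vectors all choices agree.\<close>

lemma dird_eq:
  assumes "v \<in> tangent_space M p" "openin (top_of_set M) U" "p \<in> U"
    "(Y has_derivative D) (at p within U)"
  shows "dird U Y p v = D v"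
proof -
  have "(Y has_derivative frechet_derivative Y (at p within U)) (at p within U)"
    using assms(4) frechet_derivative_works by (auto simp: differentiable_def)
  then show ?thesis unfolding dird_def using tangent_derivative_unique assms by blast
qed

lemma local_param_tangent:
  assumes "local_param M V \<psi>" "x \<in> V"
  shows "frechet_derivative \<psi> (at x) v \<in> tangent_space M (\<psi> x)"
proof -
  have V: "open V" "\<And>k. Ck_on k V \<psi>" using assms(1) by (auto simp: local_param_def smooth_on_def)
  have VM: "\<psi> ` V \<subseteq> M" using assms(1) openin_imp_subset unfolding local_param_def by blast
  let ?l = "\<lambda>t::real. x + t *\<^sub>R v"
  have "continuous_on UNIV ?l" by (intro continuous_intros)
  then have "open (?l -` V)" using V(1) open_vimage by blast
  then obtain e where e: "e > 0" "ball 0 e \<subseteq> ?l -` V"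
    using assms(2) open_contains_ball[of "?l -` V"] by force
  have be: "ball 0 e = {-e<..<e}" by (auto simp: dist_real_def)
  have oe: "open {-e<..<e}" by simp
  have Ck: "Ck_on k {-e<..<e} ?l" for k
    by (intro Ck_on_add oe Ck_on_const Ck_on_bounded_linear[OF bounded_linear_scaleR_left] Ck_on_ident)
  have "?l ` {-e<..<e} \<subseteq> V" using e(2) unfolding be by blast
  then have "Ck_on k {-e<..<e} (\<lambda>t. \<psi> (?l t))" for k
    by (rule Ck_on_compose[OF oe V(1) _ Ck V(2)])
  then have "smooth_on {-e<..<e} (\<lambda>t. \<psi> (?l t))" unfolding smooth_on_def by auto
  moreover have "((\<lambda>t. \<psi> (?l t)) has_vector_derivative frechet_derivative \<psi> (at x) v) (at 0)"
  proof -
    have 1: "(?l has_derivative (\<lambda>t. t *\<^sub>R v)) (at 0)" by (auto intro!: derivative_eq_intros)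
    have 2: "(\<psi> has_derivative frechet_derivative \<psi> (at x)) (at (?l 0))"
      using Ck_on_Suc_has_derivative[OF V(2) assms(2)] by simp
    show ?thesis unfolding has_vector_derivative_def
      using has_derivative_compose[OF 1 2] linear_cmul[OF has_derivative_linear[OF 2]] by simp
  qed
  moreover have "(\<lambda>t. \<psi> (?l t)) ` {-e<..<e} \<subseteq> M" using e(2) VM be by auto
  ultimately show ?thesis
    unfolding tangent_space_def using e(1)
    by (intro CollectI exI[of _ e] exI[of _ "\<lambda>t. \<psi> (?l t)"]) simp
qed

text \<open>Product rule for a bilinear form that varies with the point, when its derivative is
  known for constant arguments only. It is applied to the metric along N and to the Christoffel form
  along a parametrization.\<close>

lemma has_derivative_bilinear_family:
  fixes B :: "'x::real_normed_vector \<Rightarrow> 'a::euclidean_space \<Rightarrow> 'b::euclidean_space \<Rightarrow> 'c::real_normed_vector"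
  assumes p: "p \<in> S" and B: "\<And>q. q \<in> S \<Longrightarrow> bilinear (B q)" and DB: "\<And>w. bilinear (DB w)"
    and d: "\<And>u v. ((\<lambda>q. B q u v) has_derivative (\<lambda>w. DB w u v)) (at p within S)"
    and F: "(F has_derivative F') (at p within S)" and G: "(G has_derivative G') (at p within S)"
  shows "((\<lambda>q. B q (F q) (G q)) has_derivative
    (\<lambda>w. DB w (F p) (G p) + B p (F' w) (G p) + B p (F p) (G' w))) (at p within S)"
proof -
  have ex: "A u v = (\<Sum>(i, j)\<in>Basis \<times> Basis. ((u \<bullet> i) * (v \<bullet> j)) *\<^sub>R A i j)"
    if "bilinear A" for A :: "'a \<Rightarrow> 'b \<Rightarrow> 'c" and u v
  proof -
    have "A u v = A (\<Sum>i\<in>Basis. (u \<bullet> i) *\<^sub>R i) (\<Sum>j\<in>Basis. (v \<bullet> j) *\<^sub>R j)"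
      by (simp only: euclidean_representation)
    also have "\<dots> = (\<Sum>(i, j)\<in>Basis \<times> Basis. A ((u \<bullet> i) *\<^sub>R i) ((v \<bullet> j) *\<^sub>R j))"
      using that by (rule bilinear_sum)
    finally show ?thesis using that by (simp add: bilinear_lmul bilinear_rmul case_prod_unfold)
  qed
  have "((\<lambda>q. \<Sum>(i, j)\<in>Basis \<times> Basis. ((F q \<bullet> i) * (G q \<bullet> j)) *\<^sub>R B q i j) has_derivative
      (\<lambda>w. \<Sum>(i, j)\<in>Basis \<times> Basis. ((F p \<bullet> i) * (G p \<bullet> j)) *\<^sub>R DB w i j
        + ((F' w \<bullet> i) * (G p \<bullet> j)) *\<^sub>R B p i j + ((F p \<bullet> i) * (G' w \<bullet> j)) *\<^sub>R B p i j)) (at p within S)"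
    unfolding case_prod_unfold
    by (rule has_derivative_sum) (auto intro!: derivative_eq_intros d F G simp: algebra_simps)
  then have "((\<lambda>q. \<Sum>(i, j)\<in>Basis \<times> Basis. ((F q \<bullet> i) * (G q \<bullet> j)) *\<^sub>R B q i j) has_derivative
      (\<lambda>w. DB w (F p) (G p) + B p (F' w) (G p) + B p (F p) (G' w))) (at p within S)"
    by (rule has_derivative_eq_rhs)
      (subst ex[OF DB], subst (2 3) ex[OF B[OF p]], simp add: case_prod_unfold sum.distrib)
  then show ?thesis
    by (rule has_derivative_transform[OF p, rotated]) (rule ex[OF B])
qed

section \<open>Umbilical hypersurfaces\<close>

text \<open>\<open>\<Gamma>\<close> is an independent parameter: a candidate connection form,
  required on \<Omega> to be torsion free and compatible with g. Its agreement with
  \<open>christoffel\<close> is derived in \<open>christoffel_eq\<close>.\<close>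

locale hypersurface =
  fixes k :: "'k::finite itself" and \<Omega> :: "'a::euclidean_space set"
    and g :: "'a \<Rightarrow> 'a \<Rightarrow> 'a \<Rightarrow> real" and \<Gamma> :: "'a \<Rightarrow> 'a \<Rightarrow> 'a \<Rightarrow> 'a"
    and M :: "'a set" and N :: "'a \<Rightarrow> 'a"
  assumes metric: "p \<in> \<Omega> \<Longrightarrow> bilinear (g p)" "p \<in> \<Omega> \<Longrightarrow> g p u v = g p v u"
      "p \<in> \<Omega> \<Longrightarrow> u \<noteq> 0 \<Longrightarrow> g p u u > 0"
    and smooth_metric: "smooth_on \<Omega> (\<lambda>q. g q u v)"
    and \<Gamma>: "p \<in> \<Omega> \<Longrightarrow> bilinear (\<Gamma> p)" "p \<in> \<Omega> \<Longrightarrow> \<Gamma> p u v = \<Gamma> p v u"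
    and compatible: "p \<in> \<Omega> \<Longrightarrow>
      ((\<lambda>q. g q u v) has_derivative (\<lambda>w. g p (\<Gamma> p w u) v + g p u (\<Gamma> p w v))) (at p)"
    and M: "M \<subseteq> \<Omega>" "submanifold k M" "CARD('k) + 1 = DIM('a)"
    and N: "unit_normal_field g M N"
begin

text \<open>Once compatibility is inserted into the Koszul expression, symmetry of
  \<open>\<Gamma>\<close> and of the metric cancels four of the six terms; definiteness of the
  metric gives uniqueness.\<close>

lemma christoffel_eq:
  assumes p: "p \<in> \<Omega>"
  shows "christoffel g p u v = \<Gamma> p u v"
proof -
  have fd: "frechet_derivative (\<lambda>q. g q u v) (at p) w = g p (\<Gamma> p w u) v + g p u (\<Gamma> p w v)" for u v w
    by (simp add: frechet_derivative_at[OF compatible[OF p], symmetric])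
  have koszul: "frechet_derivative (\<lambda>q. g q v z) (at p) u + frechet_derivative (\<lambda>q. g q u z) (at p) v
      - frechet_derivative (\<lambda>q. g q u v) (at p) z = 2 * g p (\<Gamma> p u v) z" for z
    unfolding fd using metric(2)[OF p, of v "\<Gamma> p u z"] metric(2)[OF p, of u "\<Gamma> p v z"]
      \<Gamma>(2)[OF p, of z u] \<Gamma>(2)[OF p, of z v] \<Gamma>(2)[OF p, of v u] by simp
  show ?thesis
    unfolding christoffel_def koszul
  proof (rule the_equality)
    fix w assume "\<forall>z. 2 * g p w z = 2 * g p (\<Gamma> p u v) z"
    then have "g p (w - \<Gamma> p u v) (w - \<Gamma> p u v) = 0"
      using bilinear_lsub[OF metric(1)[OF p]] by simp
    then show "w = \<Gamma> p u v" using metric(3)[OF p, of "w - \<Gamma> p u v"] by fastforce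
  qed simp
qed

lemma N_smooth: "smooth_within M N"
  and N_unit: "p \<in> M \<Longrightarrow> g p (N p) (N p) = 1"
  and N_normal: "p \<in> M \<Longrightarrow> v \<in> tangent_space M p \<Longrightarrow> g p (N p) v = 0"
  using N unfolding unit_normal_field_def by auto

lemma in_\<Omega>: "p \<in> M \<Longrightarrow> p \<in> \<Omega>"
  using M(1) by auto

text \<open>A dimension count: the tangent space, defined by curves and not visibly a subspace, lies
  between the range of an injective derivative, of codimension 1, and the kernel of g(N, -), which
  is a proper subspace because g(N, N) = 1. Hence all three coincide.\<close>

lemma tangent_space_eq:
  assumes \<psi>: "local_param M V (\<psi> :: real^'k \<Rightarrow> 'a)" and x: "x \<in> V"
  shows "tangent_space M (\<psi> x) = range (frechet_derivative \<psi> (at x))"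
    and "tangent_space M (\<psi> x) = {v. g (\<psi> x) (N (\<psi> x)) v = 0}"
proof -
  let ?p = "\<psi> x" and ?R = "range (frechet_derivative \<psi> (at x))"
  let ?H = "{v. g ?p (N ?p) v = 0}"
  have p: "?p \<in> M" using \<psi> x openin_imp_subset unfolding local_param_def by blast
  have lin: "linear (frechet_derivative \<psi> (at x))"
    using \<psi> x Ck_on_Suc_has_derivative has_derivative_linear
    unfolding local_param_def smooth_on_def by blast
  have linN: "linear (g ?p (N ?p))" using metric(1)[OF in_\<Omega>[OF p]] by (simp add: bilinear_def)
  have sub: "subspace ?R" "subspace ?H"
    using linear_subspace_image[OF lin subspace_UNIV] linear_subspace_kernel[OF linN] by auto
  have "dim ?R = CARD('k)"
    using dim_image_eq[OF lin, of UNIV] \<psi> x by (simp add: local_param_def)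
  moreover have "dim ?H \<noteq> DIM('a)"
  proof
    assume "dim ?H = DIM('a)"
    then have "?H = UNIV" using dim_eq_full[of ?H] span_eq_iff[of ?H] sub(2) by metis
    then have "g ?p (N ?p) (N ?p) = 0" by blast
    then show False using N_unit[OF p] by simp
  qed
  then have "dim ?H < DIM('a)" using dim_subset_UNIV[of ?H] by linarith
  ultimately have "dim ?H \<le> dim ?R" using M(3) by linarith
  moreover have RT: "?R \<subseteq> tangent_space M ?p" using local_param_tangent[OF \<psi> x] by blast
  moreover have TH: "tangent_space M ?p \<subseteq> ?H" using N_normal[OF p] by blast
  ultimately have "?R = ?H" using subspace_dim_equal[OF sub] by blast
  then show "tangent_space M ?p = ?R" "tangent_space M ?p = ?H" using RT TH by auto
qed

lemma tangent_iff:
  assumes "p \<in> M"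
  shows "v \<in> tangent_space M p \<longleftrightarrow> g p (N p) v = 0"
proof -
  obtain V and \<psi> :: "real^'k \<Rightarrow> 'a" where \<psi>: "local_param M V \<psi>" "p \<in> \<psi> ` V"
    using M(2) assms unfolding submanifold_def by blast
  then obtain x where "x \<in> V" "\<psi> x = p" by blast
  with \<psi>(1) show ?thesis using tangent_space_eq(2) by blast
qed

lemma tangent_subspace: "p \<in> M \<Longrightarrow> subspace (tangent_space M p)"
  using metric(1)[OF in_\<Omega>]
  by (auto simp: subspace_def tangent_iff bilinear_radd bilinear_rmul bilinear_rzero)

lemma N_derivative:
  assumes "p \<in> M"
  shows "(N has_derivative dird M N p) (at p within M)"
  using smooth_within_differentiable[OF N_smooth assms]
  unfolding dird_def[abs_def] frechet_derivative_works .

lemma shape_operator_eq: "p \<in> M \<Longrightarrow> shape_operator g M N p v = - (dird M N p v + \<Gamma> p v (N p))"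
  by (simp add: shape_operator_def levi_civita_def christoffel_eq in_\<Omega>)

lemma shape_operator_linear:
  assumes "p \<in> M"
  shows "linear (shape_operator g M N p)"
proof (rule linearI)
  have D: "linear (dird M N p)" using N_derivative[OF assms] has_derivative_linear by blast
  note B = \<Gamma>(1)[OF in_\<Omega>[OF assms]]
  show "shape_operator g M N p (u + v) = shape_operator g M N p u + shape_operator g M N p v" for u v
    by (simp add: shape_operator_eq assms linear_add[OF D] bilinear_ladd[OF B])
  show "shape_operator g M N p (c *\<^sub>R v) = c *\<^sub>R shape_operator g M N p v" for c v
    by (simp add: shape_operator_eq assms linear_cmul[OF D] bilinear_lmul[OF B] algebra_simps)
qed

lemma bilinear_metric_derivative:
  assumes "p \<in> \<Omega>"
  shows "bilinear (\<lambda>u v. g p (\<Gamma> p w u) v + g p u (\<Gamma> p w v))"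
  using metric(1)[OF assms] \<Gamma>(1)[OF assms]
  unfolding bilinear_def linear_iff by (simp add: algebra_simps)

text \<open>Differentiating g(N, N) = 1 along v shows that the covariant derivative of N is
  orthogonal to N. The two derivatives of this function within M need only agree on tangent
  vectors.\<close>

lemma shape_operator_tangent:
  assumes p: "p \<in> M" and v: "v \<in> tangent_space M p"
  shows "shape_operator g M N p v \<in> tangent_space M p"
proof -
  note p' = in_\<Omega>[OF p]
  let ?D = "\<lambda>w. (g p (\<Gamma> p w (N p)) (N p) + g p (N p) (\<Gamma> p w (N p)))
       + g p (dird M N p w) (N p) + g p (N p) (dird M N p w)"
  have "((\<lambda>q. g q (N q) (N q)) has_derivative ?D) (at p within M)"
    using p M(1) metric(1) bilinear_metric_derivative[OF p'] compatible[OF p'] N_derivative[OF p]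
    by (intro has_derivative_bilinear_family[where B=g and
          DB="\<lambda>w u v. g p (\<Gamma> p w u) v + g p u (\<Gamma> p w v)"])
      (auto intro: has_derivative_at_withinI)
  moreover have "((\<lambda>q. g q (N q) (N q)) has_derivative (\<lambda>w. 0)) (at p within M)"
    by (rule has_derivative_transform[OF p _ has_derivative_const[of 1]]) (simp add: N_unit)
  ultimately have "?D v = 0"
    by (rule tangent_derivative_unique[OF v openin_subtopology_self p])
  then have "g p (N p) (\<Gamma> p v (N p)) + g p (N p) (dird M N p v) = 0"
    using metric(2)[OF p', of "\<Gamma> p v (N p)" "N p"] metric(2)[OF p', of "dird M N p v" "N p"] by linarith
  then show ?thesis
    by (simp add: tangent_iff p shape_operator_eq bilinear_radd[OF metric(1)[OF p']]
        bilinear_rneg[OF metric(1)[OF p']] del: minus_add_distrib)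
qed

lemma tangent_extension:
  assumes p: "p \<in> M" and v: "v \<in> tangent_space M p"
  obtains Y where "vector_field M M Y" "Y p = v"
proof
  let ?Y = "\<lambda>q. v - g q v (N q) *\<^sub>R N q"
  \<comment> \<open>Smoothness of the metric is available for constant arguments only, so N is
    expanded in the fixed basis.\<close>
  have gN: "g q v (N q) = (\<Sum>b\<in>Basis. (N q \<bullet> b) * g q v b)" if "q \<in> M" for q
  proof -
    have l: "linear (g q v)" using metric(1)[OF in_\<Omega>[OF that]] by (simp add: bilinear_def)
    have "g q v (\<Sum>b\<in>Basis. (N q \<bullet> b) *\<^sub>R b) = (\<Sum>b\<in>Basis. (N q \<bullet> b) * g q v b)"
      by (simp add: linear_sum[OF l] linear_cmul[OF l])
    then show ?thesis by (simp add: euclidean_representation)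
  qed
  have "smooth_within M (\<lambda>q. \<Sum>b\<in>Basis. (N q \<bullet> b) * g q v b)"
    by (rule smooth_within_sum, rule smooth_within_bounded_bilinear[OF bounded_bilinear_mult
          smooth_within_bounded_linear[OF bounded_linear_inner_left N_smooth]
          smooth_on_imp_smooth_within[OF smooth_metric M(1)]])
  then have "smooth_within M (\<lambda>q. (\<Sum>b\<in>Basis. (N q \<bullet> b) * g q v b) *\<^sub>R N q)"
    by (rule smooth_within_bounded_bilinear[OF bounded_bilinear_scaleR _ N_smooth])
  then have "smooth_within M (\<lambda>q. v + (-1) *\<^sub>R ((\<Sum>b\<in>Basis. (N q \<bullet> b) * g q v b) *\<^sub>R N q))"
    by (rule smooth_within_add[OF smooth_within_const smooth_within_bounded_linear[OF bounded_linear_scaleR_right]])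
  then have "smooth_within M ?Y"
    unfolding smooth_within_def by (simp add: gN)
  moreover have "?Y q \<in> tangent_space M q" if "q \<in> M" for q
    using metric(2)[OF in_\<Omega>[OF that], of v "N q"] that
    by (simp add: tangent_iff bilinear_rsub[OF metric(1)[OF in_\<Omega>[OF that]]]
        bilinear_rmul[OF metric(1)[OF in_\<Omega>[OF that]]] N_unit)
  ultimately show "vector_field M M ?Y" by (simp add: vector_field_def)
  show "?Y p = v"
    using N_normal[OF p v] metric(2)[OF in_\<Omega>[OF p]] by simp
qed

section \<open>From vanishing Lie derivatives to umbilicity\<close>

lemma vector_field_scale:
  assumes "vector_field M M X"
  shows "vector_field M M (\<lambda>q. (1 + a \<bullet> (q - p)) *\<^sub>R X q)"
proof -
  have "smooth_within M (\<lambda>q. 1 + (- (a \<bullet> p) + a \<bullet> q))"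
    by (rule smooth_within_add[OF smooth_within_const smooth_within_add[OF smooth_within_const
          smooth_within_bounded_linear[OF bounded_linear_inner_right smooth_within_ident]]])
  then have "smooth_within M (\<lambda>q. 1 + a \<bullet> (q - p))"
    by (simp add: inner_diff_right)
  then show ?thesis using assms tangent_subspace
    by (auto simp: vector_field_def subspace_def
        intro!: smooth_within_bounded_bilinear[OF bounded_bilinear_scaleR])
qed

text \<open>The scaling function is chosen with value 1 at \<open>p\<close>, so that the term \<open>[f X, A Y]\<close> changes
  only by the derivative of \<open>f\<close>; no differentiability of \<open>A Y\<close> is involved.\<close>

lemma lie_derivative_scale:
  assumes p: "p \<in> M" and X: "vector_field M M X" and Y: "vector_field M M Y"
  defines "A \<equiv> shape_operator g M N"
  shows "lie_derivative M (\<lambda>q. (1 + a \<bullet> (q - p)) *\<^sub>R X q) A Y p =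
    lie_derivative M X A Y p - (a \<bullet> A p (Y p)) *\<^sub>R X p + (a \<bullet> Y p) *\<^sub>R A p (X p)"
proof -
  let ?X = "\<lambda>q. (1 + a \<bullet> (q - p)) *\<^sub>R X q"
  have DX: "(X has_derivative dird M X p) (at p within M)"
    using X p smooth_within_differentiable
    unfolding vector_field_def dird_def[abs_def] frechet_derivative_works by blast
  have "(?X has_derivative (\<lambda>w. dird M X p w + (a \<bullet> w) *\<^sub>R X p)) (at p within M)"
    by (auto intro!: derivative_eq_intros DX)
  then have dX: "dird M ?X p w = dird M X p w + (a \<bullet> w) *\<^sub>R X p" if "w \<in> tangent_space M p" for w
    using dird_eq[OF that openin_subtopology_self p] by blast
  have Yp: "Y p \<in> tangent_space M p" using Y p by (simp add: vector_field_def)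
  have AY: "A p (Y p) \<in> tangent_space M p" unfolding A_def by (rule shape_operator_tangent[OF p Yp])
  have lin: "linear (A p)" unfolding A_def by (rule shape_operator_linear[OF p])
  show ?thesis
    unfolding lie_derivative_def lie_bracket_def dX[OF Yp] dX[OF AY]
    by (simp add: linear_diff[OF lin] linear_add[OF lin] linear_cmul[OF lin])
qed

lemma umbilical_if_scale_invariant:
  assumes p: "p \<in> M" and X: "vector_field M M X" "X p \<noteq> 0"
    and inv: "\<And>a Y. vector_field M M Y \<Longrightarrow>
      lie_derivative M (\<lambda>q. (1 + a \<bullet> (q - p)) *\<^sub>R X q) (shape_operator g M N) Y p = 0"
  obtains \<alpha> where "\<And>v. v \<in> tangent_space M p \<Longrightarrow> shape_operator g M N p v = \<alpha> *\<^sub>R v"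
proof -
  let ?A = "shape_operator g M N p" and ?\<xi> = "X p"
  have key: "(a \<bullet> ?A v) *\<^sub>R ?\<xi> = (a \<bullet> v) *\<^sub>R ?A ?\<xi>" if v: "v \<in> tangent_space M p" for a v
  proof -
    obtain Y where Y: "vector_field M M Y" "Y p = v" using tangent_extension[OF p v] .
    \<comment> \<open>For \<open>a = 0\<close> the scaling function is 1, so the hypothesis covers X
      itself; subtracting this case from the one for general a isolates the two terms of
      \<open>lie_derivative_scale\<close> that contain a.\<close>
    have "lie_derivative M X (shape_operator g M N) Y p = 0" using inv[OF Y(1), of 0] by simp
    then show ?thesis
      using inv[OF Y(1), of a] lie_derivative_scale[OF p X(1) Y(1), of a] Y(2) by simp
  qed
  have \<xi>: "?\<xi> \<in> tangent_space M p" using X p by (simp add: vector_field_def)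
  \<comment> \<open>This value is forced by \<open>key\<close> with \<open>?\<xi>\<close> for both v
    and a. With \<open>?\<xi>\<close> as an eigenvector, \<open>key\<close> then compares Av and
    \<alpha>v against every a.\<close>
  define \<alpha> where "\<alpha> = (?\<xi> \<bullet> ?A ?\<xi>) / (?\<xi> \<bullet> ?\<xi>)"
  have A\<xi>: "?A ?\<xi> = \<alpha> *\<^sub>R ?\<xi>"
  proof -
    have "(?\<xi> \<bullet> ?\<xi>) *\<^sub>R ?A ?\<xi> = (?\<xi> \<bullet> ?\<xi>) *\<^sub>R (\<alpha> *\<^sub>R ?\<xi>)"
      using key[OF \<xi>, of ?\<xi>] X(2) by (simp add: \<alpha>_def)
    then show ?thesis using X(2) by (simp only: real_vector.scale_cancel_left inner_eq_zero_iff) simp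
  qed
  show thesis
  proof (rule that)
    fix v assume v: "v \<in> tangent_space M p"
    have "a \<bullet> ?A v = a \<bullet> (\<alpha> *\<^sub>R v)" for a
    proof -
      have "(a \<bullet> ?A v) *\<^sub>R ?\<xi> = (a \<bullet> (\<alpha> *\<^sub>R v)) *\<^sub>R ?\<xi>" using key[OF v, of a] A\<xi> by (simp add: mult.commute)
      then show ?thesis using X(2) by (simp only: real_vector.scale_cancel_right) simp
    qed
    then show "?A v = \<alpha> *\<^sub>R v" by (metis vector_eq_rdot inner_commute)
  qed
qed

text \<open>The Codazzi equation in coordinates: the second derivatives of \<open>N \<circ> \<psi>\<close> are symmetric and
  \<open>\<nabla>N = -\<alpha>\<close>, so the curvature \<open>R(w,u)N\<close> equals \<open>w(\<alpha>) u - u(\<alpha>) w\<close> up to sign.\<close>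

lemma umbilical_codazzi:
  assumes umbilical: "\<And>q. q \<in> M \<Longrightarrow> \<exists>\<alpha>. \<forall>v\<in>tangent_space M q. shape_operator g M N q v = \<alpha> *\<^sub>R v"
    and D\<Gamma>: "\<And>q u v. q \<in> \<Omega> \<Longrightarrow> ((\<lambda>q. \<Gamma> q u v) has_derivative (\<lambda>w. D\<Gamma> q w u v)) (at q)"
      "\<And>q w. q \<in> \<Omega> \<Longrightarrow> bilinear (D\<Gamma> q w)"
    and p: "p \<in> M" and u: "u \<in> tangent_space M p" "u \<noteq> 0" and w: "w \<in> tangent_space M p"
  obtains a b where "D\<Gamma> p w u (N p) - D\<Gamma> p u w (N p)
      - \<Gamma> p u (\<Gamma> p w (N p)) + \<Gamma> p w (\<Gamma> p u (N p)) = a *\<^sub>R u + b *\<^sub>R w"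
proof -
  obtain \<alpha> where \<alpha>: "\<And>q v. q \<in> M \<Longrightarrow> v \<in> tangent_space M q \<Longrightarrow> shape_operator g M N q v = \<alpha> q *\<^sub>R v"
    using umbilical by metis
  obtain V\<^sub>0 and \<psi> :: "real^'k \<Rightarrow> 'a" where \<psi>: "local_param M V\<^sub>0 \<psi>" "p \<in> \<psi> ` V\<^sub>0"
    using M(2) p unfolding submanifold_def by blast
  then obtain x where x: "x \<in> V\<^sub>0" "\<psi> x = p" by blast
  note \<psi> = \<psi>(1)
  obtain W F where F: "p \<in> W" "smooth_on W F" "\<And>q. q \<in> W \<inter> M \<Longrightarrow> F q = N q"
    using N_smooth p unfolding smooth_within_def by metis
  \<comment> \<open>On this smaller chart domain N agrees with its smooth extension F, so that N
    composed with \<psi> is smooth on an open set and has symmetric second derivatives.\<close>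
  define V where "V = V\<^sub>0 \<inter> \<psi> -` W"
  have V0: "open V\<^sub>0" "\<And>k. Ck_on k V\<^sub>0 \<psi>" "\<psi> ` V\<^sub>0 \<subseteq> M"
    using \<psi> openin_imp_subset unfolding local_param_def smooth_on_def by blast+
  have W: "open W" "\<And>k. Ck_on k W F" using F(2) by (auto simp: smooth_on_def)
  have "continuous_on V\<^sub>0 \<psi>" using V0(2)[of 0] by simp
  then have V: "open V" "x \<in> V" "V \<subseteq> V\<^sub>0"
    unfolding V_def using continuous_open_preimage[OF _ V0(1) W(1)] x F(1) by auto
  have \<psi>M: "\<psi> y \<in> M" if "y \<in> V" for y using V0(3) V(3) that by blast
  have C\<psi>: "Ck_on k V \<psi>" for k using Ck_on_mono[OF V0(2) V(3)] .
  define n where "n = (\<lambda>y. N (\<psi> y))"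
  have Cn: "Ck_on k V n" for k
  proof (rule Ck_on_cong[OF V(1)])
    have "\<psi> ` V \<subseteq> W" by (auto simp: V_def)
    then show "Ck_on k V (\<lambda>y. F (\<psi> y))" by (rule Ck_on_compose[OF V(1) W(1) _ C\<psi> W(2)])
    show "F (\<psi> y) = n y" if "y \<in> V" for y
      using F(3)[of "\<psi> y"] that \<psi>M[OF that] by (simp add: n_def V_def)
  qed
  let ?D = "\<lambda>f y e. frechet_derivative f (at y) e"
  note d\<psi> = Ck_on_Suc_has_derivative[OF C\<psi>] and dn = Ck_on_Suc_has_derivative[OF Cn]
  have tangent: "?D \<psi> y e \<in> tangent_space M (\<psi> y)" if "y \<in> V" for y e
    using local_param_tangent[OF \<psi>] that V(3) by blast
  have n_deriv: "?D n y e = - (\<alpha> (\<psi> y) *\<^sub>R ?D \<psi> y e) - \<Gamma> (\<psi> y) (?D \<psi> y e) (n y)" if y: "y \<in> V" for y e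
  proof -
    have "(N has_derivative dird M N (\<psi> y)) (at (\<psi> y) within \<psi> ` V)"
      by (rule has_derivative_subset[OF N_derivative[OF \<psi>M[OF y]]]) (use \<psi>M in blast)
    from has_derivative_in_compose[OF has_derivative_at_withinI[OF d\<psi>[OF y]] this]
    have "(n has_derivative (\<lambda>e. dird M N (\<psi> y) (?D \<psi> y e))) (at y)"
      unfolding n_def at_within_open[OF y V(1)] .
    then have 1: "?D n y e = dird M N (\<psi> y) (?D \<psi> y e)" using frechet_derivative_at by metis
    have 2: "- (dird M N (\<psi> y) (?D \<psi> y e) + \<Gamma> (\<psi> y) (?D \<psi> y e) (n y)) = \<alpha> (\<psi> y) *\<^sub>R ?D \<psi> y e"
      using \<alpha>[OF \<psi>M[OF y] tangent[OF y]] by (simp add: shape_operator_eq[OF \<psi>M[OF y]] n_def)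
    show ?thesis by (simp add: 1 2[symmetric])
  qed
  obtain e\<^sub>u e\<^sub>w where e: "?D \<psi> x e\<^sub>u = u" "?D \<psi> x e\<^sub>w = w"
    using u(1) w tangent_space_eq(1)[OF \<psi> x(1)] unfolding x(2) by (metis imageE)
  have p\<Omega>: "p \<in> \<Omega>" using p in_\<Omega> by blast
  have nx: "n x = N p" by (simp add: n_def x)
  have C1: "Ck_on (Suc 0) V (\<lambda>y. ?D \<psi> y e)" "Ck_on (Suc 0) V (\<lambda>y. ?D n y e)" for e
    using C\<psi>[of "Suc (Suc 0)"] Cn[of "Suc (Suc 0)"] by auto
  define \<psi>2 where "\<psi>2 e = ?D (\<lambda>y. ?D \<psi> y e) x" for e
  have d2: "((\<lambda>y. ?D \<psi> y e) has_derivative \<psi>2 e) (at x)"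
    "((\<lambda>y. ?D n y e) has_derivative ?D (\<lambda>y. ?D n y e) x) (at x)" for e
    unfolding \<psi>2_def using Ck_on_Suc_has_derivative[OF _ V(2)] C1 by blast+
  define \<gamma>' where "\<gamma>' e e' = D\<Gamma> p (?D \<psi> x e') (?D \<psi> x e) (N p) + \<Gamma> p (\<psi>2 e e') (N p)
      + \<Gamma> p (?D \<psi> x e) (?D n x e')" for e e'
  have d\<gamma>: "((\<lambda>y. \<Gamma> (\<psi> y) (?D \<psi> y e) (n y)) has_derivative \<gamma>' e) (at x)" for e
  proof -
    have "((\<lambda>y. \<Gamma> (\<psi> y) u v) has_derivative (\<lambda>e. D\<Gamma> p (?D \<psi> x e) u v)) (at x)" for u v
      using has_derivative_compose[OF d\<psi>[OF V(2)], unfolded x(2), OF D\<Gamma>(1)[OF p\<Omega>]] by simp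
    then have 1: "((\<lambda>y. \<Gamma> (\<psi> y) u v) has_derivative (\<lambda>e. D\<Gamma> p (?D \<psi> x e) u v)) (at x within V)" for u v
      using has_derivative_at_withinI by blast
    have "((\<lambda>y. \<Gamma> (\<psi> y) (?D \<psi> y e) (n y)) has_derivative (\<lambda>e'. D\<Gamma> p (?D \<psi> x e') (?D \<psi> x e) (n x)
        + \<Gamma> (\<psi> x) (\<psi>2 e e') (n x) + \<Gamma> (\<psi> x) (?D \<psi> x e) (?D n x e'))) (at x within V)"
      by (rule has_derivative_bilinear_family[where B="\<lambda>y. \<Gamma> (\<psi> y)", OF V(2) \<Gamma>(1)[OF in_\<Omega>[OF \<psi>M]]
            D\<Gamma>(2)[OF p\<Omega>] 1 has_derivative_at_withinI[OF d2(1)] has_derivative_at_withinI[OF dn[OF V(2)]]])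
    then show ?thesis unfolding at_within_open[OF V(2,1)] \<gamma>'_def[abs_def] nx x(2) .
  qed
  \<comment> \<open>A differentiable formula for \<alpha> along \<psi>: the relation
    \<open>n_deriv\<close> in direction \<open>e\<^sub>u\<close>, paired with u in the ambient inner
    product and solved for \<alpha>. The denominator is nonzero at x because u is nonzero, hence
    also near x.\<close>
  define a where "a = (\<lambda>y. - ((?D n y e\<^sub>u + \<Gamma> (\<psi> y) (?D \<psi> y e\<^sub>u) (n y)) \<bullet> u) / (?D \<psi> y e\<^sub>u \<bullet> u))"
  have uu: "?D \<psi> x e\<^sub>u \<bullet> u \<noteq> 0" using u(2) e by simp
  have "\<exists>a'. (a has_derivative a') (at x)"
    unfolding a_def
    by (rule exI, rule has_derivative_divide[OF has_derivative_minus[OF has_derivative_inner_left[OF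
              has_derivative_add[OF d2(2) d\<gamma>]]] has_derivative_inner_left[OF d2(1)] uu])
  then obtain a' where a': "(a has_derivative a') (at x)" ..
  have "((\<lambda>y. ?D \<psi> y e\<^sub>u \<bullet> u) \<longlongrightarrow> ?D \<psi> x e\<^sub>u \<bullet> u) (at x)"
    using has_derivative_continuous[OF has_derivative_inner_left[OF d2(1)]] by (simp add: isCont_def)
  then have "eventually (\<lambda>y. ?D \<psi> y e\<^sub>u \<bullet> u \<noteq> 0) (at x)"
    using uu tendsto_imp_eventually_ne by blast
  then have "eventually (\<lambda>y. ?D \<psi> y e\<^sub>u \<bullet> u \<noteq> 0 \<and> y \<in> V) (at x)"
    using eventually_at_in_open'[OF V(1,2)] by (rule eventually_conj)
  then have ev: "eventually (\<lambda>y. ?D \<psi> y e\<^sub>u \<bullet> u \<noteq> 0 \<and> y \<in> V) (nhds x)"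
    using uu V(2) by (simp add: eventually_nhds_conv_at)
  have a_eq: "a y = \<alpha> (\<psi> y)" if "?D \<psi> y e\<^sub>u \<bullet> u \<noteq> 0 \<and> y \<in> V" for y
    using that by (simp add: a_def n_deriv)
  have n2: "?D (\<lambda>y. ?D n y e) x e' = - (a x *\<^sub>R \<psi>2 e e') - a' e' *\<^sub>R ?D \<psi> x e - \<gamma>' e e'" for e e'
  proof -
    have 1: "((\<lambda>y. - (a y *\<^sub>R ?D \<psi> y e) - \<Gamma> (\<psi> y) (?D \<psi> y e) (n y)) has_derivative
        (\<lambda>e'. - (a x *\<^sub>R \<psi>2 e e' + a' e' *\<^sub>R ?D \<psi> x e) - \<gamma>' e e')) (at x)"
      by (intro has_derivative_diff has_derivative_minus has_derivative_scaleR a' d2 d\<gamma>)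
    have 2: "eventually (\<lambda>y. - (a y *\<^sub>R ?D \<psi> y e) - \<Gamma> (\<psi> y) (?D \<psi> y e) (n y) = ?D n y e) (nhds x)"
      using ev by (rule eventually_mono) (simp add: a_eq n_deriv)
    have "((\<lambda>y. ?D n y e) has_derivative
        (\<lambda>e'. - (a x *\<^sub>R \<psi>2 e e' + a' e' *\<^sub>R ?D \<psi> x e) - \<gamma>' e e')) (at x)"
      by (rule has_derivative_transform_eventually[OF 1])
        (use 2 in \<open>simp_all add: eventually_nhds_conv_at\<close>)
    from fun_cong[OF frechet_derivative_at[OF this], of e', symmetric]
    show ?thesis by simp
  qed
  \<comment> \<open>Symmetry is used for n and for \<psi>: equating the two expressions
    \<open>n2\<close> for the mixed derivative of n, the second derivatives of \<psi> cancel and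
    only the derivatives of \<alpha> and the terms \<open>\<gamma>'\<close> survive.\<close>
  have "?D (\<lambda>y. ?D n y e\<^sub>u) x e\<^sub>w = ?D (\<lambda>y. ?D n y e\<^sub>w) x e\<^sub>u"
    "\<psi>2 e\<^sub>u e\<^sub>w = \<psi>2 e\<^sub>w e\<^sub>u"
    unfolding \<psi>2_def using second_derivative_symmetric[OF V(1,2)] Cn C\<psi> by blast+
  then have main: "a' e\<^sub>w *\<^sub>R u + \<gamma>' e\<^sub>u e\<^sub>w = a' e\<^sub>u *\<^sub>R w + \<gamma>' e\<^sub>w e\<^sub>u"
    unfolding n2 e by (simp add: algebra_simps)
  have nw: "?D n x e' = - (\<alpha> p *\<^sub>R ?D \<psi> x e') - \<Gamma> p (?D \<psi> x e') (N p)" for e'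
    using n_deriv[OF V(2)] by (simp add: x nx)
  note B = \<Gamma>(1)[OF p\<Omega>]
  have \<gamma>'_eq: "\<gamma>' e e' = D\<Gamma> p (?D \<psi> x e') (?D \<psi> x e) (N p) + \<Gamma> p (\<psi>2 e e') (N p)
      - \<alpha> p *\<^sub>R \<Gamma> p (?D \<psi> x e) (?D \<psi> x e') - \<Gamma> p (?D \<psi> x e) (\<Gamma> p (?D \<psi> x e') (N p))" for e e'
    unfolding \<gamma>'_def nw by (simp add: bilinear_rsub[OF B] bilinear_rneg[OF B] bilinear_rmul[OF B])
  \<comment> \<open>Apart from the curvature terms, \<open>\<gamma>'\<close> contains only the mixed
    second derivative of \<psi> inside \<open>\<Gamma>\<close> and the multiple
    \<open>\<alpha> p\<close> of \<open>\<Gamma> p u w\<close>. Both are symmetric and drop out of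
    the difference.\<close>
  have "D\<Gamma> p w u (N p) - D\<Gamma> p u w (N p) - \<Gamma> p u (\<Gamma> p w (N p)) + \<Gamma> p w (\<Gamma> p u (N p))
      = \<gamma>' e\<^sub>u e\<^sub>w - \<gamma>' e\<^sub>w e\<^sub>u"
    unfolding \<gamma>'_eq e \<open>\<psi>2 e\<^sub>u e\<^sub>w = \<psi>2 e\<^sub>w e\<^sub>u\<close> using \<Gamma>(2)[OF p\<Omega>, of u w] by (simp add: algebra_simps)
  also have "\<dots> = (- a' e\<^sub>w) *\<^sub>R u + a' e\<^sub>u *\<^sub>R w" using main by (simp add: algebra_simps)
  finally show thesis by (rule that)
qed

end

section \<open>Matrix calculus\<close>

lemma cadjoint_nth [simp]: "cadjoint A $ i $ j = cnj (A $ j $ i)"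
  by (simp add: cadjoint_def)

lemma cadjoint_cadjoint [simp]: "cadjoint (cadjoint A) = A"
  by (simp add: vec_eq_iff)

lemma cadjoint_mat [simp]: "cadjoint (mat c) = mat (cnj c)"
  by (simp add: vec_eq_iff mat_def)

lemma cadjoint_mult: "cadjoint (A ** B) = cadjoint B ** cadjoint A"
  by (simp add: vec_eq_iff matrix_matrix_mult_def mult.commute)

lemma cadjoint_add: "cadjoint (A + B) = cadjoint A + cadjoint B"
  and cadjoint_diff: "cadjoint (A - B) = cadjoint A - cadjoint B"
  and cadjoint_zero [simp]: "cadjoint 0 = 0"
  by (simp_all add: vec_eq_iff)

lemma bounded_linear_cadjoint: "bounded_linear (cadjoint :: complex^'n::finite^'m::finite \<Rightarrow> _)"
  unfolding linear_conv_bounded_linear[symmetric]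
  by (rule linearI) (simp_all add: vec_eq_iff)

lemma matrix_add_rdistrib: "(A + B) ** C = A ** C + B ** (C :: complex^'k^'n)"
  by (simp add: vec_eq_iff matrix_matrix_mult_def sum.distrib distrib_right)

lemma bounded_bilinear_matrix_mult:
  "bounded_bilinear ((**) :: complex^'n::finite^'m::finite \<Rightarrow> complex^'k::finite^'n \<Rightarrow> _)"
  unfolding bilinear_conv_bounded_bilinear[symmetric] bilinear_def
  by (auto intro!: linearI simp: matrix_add_ldistrib matrix_add_rdistrib scalar_matrix_assoc matrix_scalar_ac)

lemmas matrix_mult_has_derivative = bounded_bilinear.FDERIV[OF bounded_bilinear_matrix_mult]
  and matrix_mult_diff_left = bounded_bilinear.diff_left[OF bounded_bilinear_matrix_mult]
  and matrix_mult_diff_right = bounded_bilinear.diff_right[OF bounded_bilinear_matrix_mult]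
  and matrix_mult_minus_left = bounded_bilinear.minus_left[OF bounded_bilinear_matrix_mult]
  and matrix_mult_minus_right = bounded_bilinear.minus_right[OF bounded_bilinear_matrix_mult]

lemmas matrix_mult_distribs = matrix_add_ldistrib matrix_add_rdistrib matrix_mult_diff_left
  matrix_mult_diff_right matrix_mult_minus_left matrix_mult_minus_right

lemma bounded_linear_trace: "bounded_linear (trace :: complex^'n::finite^'n \<Rightarrow> _)"
  unfolding linear_conv_bounded_linear[symmetric]
  by (rule linearI) (simp_all add: trace_def sum.distrib scaleR_sum_right)

lemma bounded_linear_mat: "bounded_linear (mat :: complex \<Rightarrow> complex^'n::finite^'n)"
  unfolding linear_conv_bounded_linear[symmetric]
  by (rule linearI) (simp_all add: vec_eq_iff mat_def)

lemma mat_mult_nth [simp]: "(mat c ** A) $ i $ j = c * (A :: complex^'n::finite^'m::finite) $ i $ j"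
  by (simp add: matrix_matrix_mult_def mat_def if_distrib[of "\<lambda>x. x * _"] cong: if_cong)

lemma mult_mat_nth [simp]: "(A ** mat c) $ i $ j = (A :: complex^'n::finite^'m::finite) $ i $ j * c"
  by (simp add: matrix_matrix_mult_def mat_def if_distrib cong: if_cong)

lemma mat_mult_commute: "mat c ** A = (A :: complex^'n::finite^'m::finite) ** mat c"
  by (simp add: vec_eq_iff)

text \<open>\<open>matrix_inv\<close> is a Hilbert choice of a two-sided inverse; a one-sided
  inverse of a square matrix is two-sided, which forces the choice.\<close>

lemma matrix_inverse_unique:
  fixes A :: "complex^'n::finite^'n"
  assumes "A ** B = mat 1"
  shows "matrix_inv A = B"
proof -
  have BA: "B ** A = mat 1" using assms matrix_left_right_inverse by blast
  then have "\<exists>A'. A ** A' = mat 1 \<and> A' ** A = mat 1" using assms by blast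
  then have "A ** matrix_inv A = mat 1" unfolding matrix_inv_def by (rule someI2_ex) blast
  then have "B ** (A ** matrix_inv A) = B" by simp
  then show ?thesis by (simp add: matrix_mul_assoc BA)
qed

lemma matrix_inv_mult:
  fixes A :: "complex^'n::finite^'n"
  assumes "det A \<noteq> 0"
  shows "A ** matrix_inv A = mat 1" "matrix_inv A ** A = mat 1"
proof -
  obtain B where "A ** B = mat 1" using assms invertible_det_nz unfolding invertible_def by blast
  then show "A ** matrix_inv A = mat 1" using matrix_inverse_unique by blast
  then show "matrix_inv A ** A = mat 1" using matrix_left_right_inverse by blast
qed

lemma det_nonzero_if_inverse: "A ** B = mat 1 \<Longrightarrow> det (A :: complex^'n::finite^'n) \<noteq> 0"
  using invertible_det_nz invertible_right_inverse by blast

text \<open>Cayley-Hamilton: the adjugate of a \<open>2 \<times> 2\<close> matrix \<open>A\<close> is \<open>tr A - A\<close>.\<close>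

lemma matrix_inv_2:
  fixes A :: "complex^2^2"
  assumes "det A \<noteq> 0"
  shows "matrix_inv A = mat (inverse (det A)) ** (mat (trace A) - A)"
proof (rule matrix_inverse_unique)
  have "A ** (mat (trace A) - A) = mat (det A)"
    by (simp add: vec_eq_iff forall_2 matrix_matrix_mult_def sum_2 trace_def mat_def det_2 algebra_simps)
  then have "mat (inverse (det A)) ** (A ** (mat (trace A) - A)) = mat (inverse (det A)) ** mat (det A)"
    by simp
  also have "\<dots> = mat 1" using assms by (simp add: vec_eq_iff) (simp add: mat_def)
  finally show "A ** (mat (inverse (det A)) ** (mat (trace A) - A)) = mat 1"
    by (simp add: matrix_mul_assoc mat_mult_commute[of _ A])
qed

lemma det_2_differentiable: "(det :: complex^2^2 \<Rightarrow> complex) differentiable (at A)"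
proof -
  have "(\<lambda>B :: complex^2^2. B $ i $ j) differentiable (at A)" for i j
    by (rule bounded_linear_imp_differentiable)
      (intro bounded_linear_compose[OF bounded_linear_vec_nth] bounded_linear_vec_nth)
  then show ?thesis unfolding det_2[abs_def] by (intro differentiable_diff differentiable_mult)
qed

lemma open_det_nonzero: "open {A :: complex^2^2. det A \<noteq> 0}"
proof -
  have "continuous_on UNIV (det :: complex^2^2 \<Rightarrow> complex)"
    by (intro differentiable_imp_continuous_on)
      (simp add: differentiable_on_def det_2_differentiable)
  then show ?thesis by (intro open_Collect_neq) auto
qed

text \<open>The explicit formula for the inverse yields only that some derivative exists; its value
  follows by differentiating \<open>B ** matrix_inv B = mat 1\<close>.\<close>

lemma matrix_inv_has_derivative:
  fixes A :: "complex^2^2"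
  assumes A: "det A \<noteq> 0"
  shows "(matrix_inv has_derivative (\<lambda>H. - (matrix_inv A ** H ** matrix_inv A))) (at A)"
proof -
  let ?I = "\<lambda>B :: complex^2^2. mat (inverse (det B)) ** (mat (trace B) - B)"
  obtain d where d: "(det has_derivative d) (at A)"
    using det_2_differentiable by (auto simp: differentiable_def)
  have "\<exists>D. (?I has_derivative D) (at A)"
    by (rule exI, rule matrix_mult_has_derivative[OF
          bounded_linear.has_derivative[OF bounded_linear_mat Deriv.has_derivative_inverse[OF A d]]
          has_derivative_diff[OF bounded_linear.has_derivative[OF bounded_linear_mat
            bounded_linear.has_derivative[OF bounded_linear_trace has_derivative_ident]] has_derivative_ident]])
  then obtain D where "(?I has_derivative D) (at A)" by blast
  then have D: "(matrix_inv has_derivative D) (at A)"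
    by (rule has_derivative_transform_within_open[OF _ open_det_nonzero])
      (simp_all add: A matrix_inv_2)
  have "((\<lambda>B. B ** matrix_inv B) has_derivative (\<lambda>H. A ** D H + H ** matrix_inv A)) (at A)"
    by (rule matrix_mult_has_derivative[OF has_derivative_ident D])
  moreover have "((\<lambda>B. B ** matrix_inv B) has_derivative (\<lambda>H. 0)) (at A)"
    by (rule has_derivative_transform_within_open[OF has_derivative_const[of "mat 1"] open_det_nonzero])
      (simp_all add: A matrix_inv_mult)
  ultimately have "(\<lambda>H. A ** D H + H ** matrix_inv A) = (\<lambda>H. 0)" by (rule has_derivative_unique)
  then have eq: "A ** D H = - (H ** matrix_inv A)" for H
    by (metis (no_types) eq_neg_iff_add_eq_0)
  have "D H = - (matrix_inv A ** H ** matrix_inv A)" for H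
  proof -
    have "matrix_inv A ** (A ** D H) = matrix_inv A ** (- (H ** matrix_inv A))" by (simp only: eq)
    then show ?thesis by (simp add: matrix_mul_assoc matrix_inv_mult[OF A] matrix_mult_minus_right)
  qed
  then have "D = (\<lambda>H. - (matrix_inv A ** H ** matrix_inv A))" by blast
  then show ?thesis using D by simp
qed

section \<open>The Bergman metric of the bounded domain\<close>

definition gram :: "complex^2^'m::finite \<Rightarrow> complex^2^2" where
  "gram Z = mat 1 - cadjoint Z ** Z"

definition gram_inv :: "complex^2^'m::finite \<Rightarrow> complex^2^2" where
  "gram_inv Z = matrix_inv (gram Z)"

text \<open>The inverse of \<open>I - Z Z\<^sup>*\<close>, in a form that only involves the inverse of a \<open>2 \<times> 2\<close> matrix.\<close>

definition cogram_inv :: "complex^2^'m::finite \<Rightarrow> complex^'m^'m" where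
  "cogram_inv Z = mat 1 + Z ** gram_inv Z ** cadjoint Z"

text \<open>The dual of W under the Hermitian Bergman form: conjugate linear in W, and equal to
  \<open>cadjoint W\<close> at the origin.\<close>

definition sharp :: "complex^2^'m::finite \<Rightarrow> complex^2^'m \<Rightarrow> complex^'m^2" where
  "sharp Z W = gram_inv Z ** cadjoint W ** cogram_inv Z"

definition bergman :: "complex^2^'m::finite \<Rightarrow> complex^2^'m \<Rightarrow> complex^2^'m \<Rightarrow> real" where
  "bergman Z X Y = Re (trace (sharp Z X ** Y))"

definition connection :: "complex^2^'m::finite \<Rightarrow> complex^'m^2" where
  "connection Z = gram_inv Z ** cadjoint Z"

text \<open>The origin of this formula: with S for \<open>connection Z\<close>, the complex linear
  parts of the derivatives of \<open>gram_inv\<close> and \<open>cogram_inv\<close> along W are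
  \<open>S ** W ** gram_inv Z\<close> and \<open>cogram_inv Z ** W ** S\<close>. Inside the trace
  that defines \<open>bergman\<close>, they turn Y into
  \<open>Y ** S ** W + W ** S ** Y\<close>.\<close>

definition bergman_christoffel :: "complex^2^'m::finite \<Rightarrow> complex^2^'m \<Rightarrow> complex^2^'m \<Rightarrow> complex^2^'m" where
  "bergman_christoffel Z U V = U ** connection Z ** V + V ** connection Z ** U"

text \<open>The derivative of \<open>connection\<close>, split into a conjugate linear part, which
  carries the curvature, and a complex linear part, which later cancels against products of
  Christoffel forms.\<close>

definition connection_deriv :: "complex^2^'m::finite \<Rightarrow> complex^2^'m \<Rightarrow> complex^'m^2" where
  "connection_deriv Z W = sharp Z W + connection Z ** W ** connection Z"

lemma gram_has_derivative:
  "(gram has_derivative (\<lambda>W. - (cadjoint Z ** W + cadjoint W ** Z))) (at Z)"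
proof -
  have "((\<lambda>Z. mat 1 - cadjoint Z ** Z) has_derivative (\<lambda>W. 0 - (cadjoint Z ** W + cadjoint W ** Z))) (at Z)"
    by (rule has_derivative_diff[OF has_derivative_const matrix_mult_has_derivative[OF
          bounded_linear.has_derivative[OF bounded_linear_cadjoint has_derivative_ident] has_derivative_ident]])
  then show ?thesis by (simp add: gram_def[abs_def])
qed

context
  fixes Z :: "complex^2^'m::finite"
  assumes Z: "det (gram Z) \<noteq> 0"
begin

lemma gram_inv_mult: "gram Z ** gram_inv Z = mat 1" "gram_inv Z ** gram Z = mat 1"
  unfolding gram_inv_def using matrix_inv_mult[OF Z] by blast+

lemma cadjoint_gram_inv: "cadjoint (gram_inv Z) = gram_inv Z"
proof -
  have "cadjoint (gram Z) = gram Z" by (simp add: gram_def cadjoint_diff cadjoint_mult)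
  then have "gram Z ** cadjoint (gram_inv Z) = mat 1"
    using arg_cong[OF gram_inv_mult(2), of cadjoint] by (simp add: cadjoint_mult)
  from matrix_inverse_unique[OF this] show ?thesis by (simp add: gram_inv_def)
qed

lemma cadjoint_connection: "cadjoint (connection Z) = Z ** gram_inv Z"
  by (simp add: connection_def cadjoint_mult cadjoint_gram_inv)

lemma gram_inv_has_derivative:
  "(gram_inv has_derivative (\<lambda>W. connection Z ** W ** gram_inv Z
     + gram_inv Z ** cadjoint W ** cadjoint (connection Z))) (at Z)"
proof -
  have "((\<lambda>Z. matrix_inv (gram Z)) has_derivative
      (\<lambda>W. - (matrix_inv (gram Z) ** (- (cadjoint Z ** W + cadjoint W ** Z)) ** matrix_inv (gram Z)))) (at Z)"
    by (rule has_derivative_compose[OF gram_has_derivative matrix_inv_has_derivative[OF Z]])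
  then show ?thesis
    unfolding gram_inv_def[abs_def, symmetric] cadjoint_connection
    by (rule has_derivative_eq_rhs) (simp add: gram_inv_def[symmetric] connection_def
        matrix_mult_distribs matrix_mul_assoc add.commute)
qed

lemma connection_has_derivative: "(connection has_derivative connection_deriv Z) (at Z)"
proof -
  have "((\<lambda>Z. gram_inv Z ** cadjoint Z) has_derivative (\<lambda>W. gram_inv Z ** cadjoint W +
      (connection Z ** W ** gram_inv Z + gram_inv Z ** cadjoint W ** cadjoint (connection Z)) ** cadjoint Z)) (at Z)"
    by (rule matrix_mult_has_derivative[OF gram_inv_has_derivative
          bounded_linear.has_derivative[OF bounded_linear_cadjoint has_derivative_ident]])
  then show ?thesis
    unfolding connection_def[abs_def, symmetric]
    by (rule has_derivative_eq_rhs) (simp add: fun_eq_iff connection_deriv_def sharp_def cogram_inv_def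
        cadjoint_mult cadjoint_gram_inv connection_def matrix_mult_distribs matrix_mul_assoc)
qed

lemma cogram_inv_has_derivative:
  "(cogram_inv has_derivative (\<lambda>W. cogram_inv Z ** W ** connection Z
     + cadjoint (connection Z) ** cadjoint W ** cogram_inv Z)) (at Z)"
proof -
  have eq: "cogram_inv = (\<lambda>Z. mat 1 + Z ** connection Z)"
    by (simp add: fun_eq_iff cogram_inv_def connection_def matrix_mul_assoc)
  have "((\<lambda>Z. mat 1 + Z ** connection Z) has_derivative
      (\<lambda>W. 0 + (Z ** connection_deriv Z W + W ** connection Z))) (at Z)"
    by (rule has_derivative_add[OF has_derivative_const
          matrix_mult_has_derivative[OF has_derivative_ident connection_has_derivative]])
  then show ?thesis
    unfolding eq
    by (rule has_derivative_eq_rhs) (simp add: fun_eq_iff connection_deriv_def sharp_def cogram_inv_def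
        cadjoint_mult cadjoint_gram_inv connection_def matrix_mult_distribs matrix_mul_assoc)
qed

lemma bergman_has_derivative:
  "((\<lambda>Z. bergman Z X Y) has_derivative (\<lambda>W. bergman Z (bergman_christoffel Z W X) Y
     + bergman Z X (bergman_christoffel Z W Y))) (at Z)"
proof -
  let ?S = "connection Z" and ?B = "gram_inv Z" and ?A = "cogram_inv Z"
  have sharp_d: "((\<lambda>Z. gram_inv Z ** cadjoint X ** cogram_inv Z) has_derivative
      (\<lambda>W. ?B ** cadjoint X ** (?A ** W ** ?S + cadjoint ?S ** cadjoint W ** ?A)
      + (?B ** 0 + (?S ** W ** ?B + ?B ** cadjoint W ** cadjoint ?S) ** cadjoint X) ** ?A)) (at Z)"
    by (rule matrix_mult_has_derivative[OF matrix_mult_has_derivative[OF gram_inv_has_derivative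
            has_derivative_const] cogram_inv_has_derivative])
  have "((\<lambda>Z. Re (trace (gram_inv Z ** cadjoint X ** cogram_inv Z ** Y))) has_derivative
      (\<lambda>W. Re (trace (?B ** cadjoint X ** ?A ** 0 + (?B ** cadjoint X ** (?A ** W ** ?S + cadjoint ?S ** cadjoint W ** ?A)
      + (?B ** 0 + (?S ** W ** ?B + ?B ** cadjoint W ** cadjoint ?S) ** cadjoint X) ** ?A) ** Y)))) (at Z)"
    by (rule bounded_linear.has_derivative[OF bounded_linear_Re bounded_linear.has_derivative[OF
            bounded_linear_trace matrix_mult_has_derivative[OF sharp_d has_derivative_const]]])
  then show ?thesis
    unfolding bergman_def sharp_def
  proof (rule has_derivative_eq_rhs, intro ext)
    fix W
    \<comment> \<open>Cyclicity carries the leading factor \<open>?S ** W\<close> to the end, where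
      it acts on Y. The terms with W itself then form the Christoffel form of W and Y; those with
      \<open>cadjoint W\<close> form the adjoint of that of W and X.\<close>
    have "trace (?S ** (W ** ?B ** cadjoint X ** ?A ** Y)) = trace (W ** ?B ** cadjoint X ** ?A ** Y ** ?S)"
      by (rule trace_mul_sym)
    moreover have "trace (W ** (?B ** cadjoint X ** ?A ** Y ** ?S)) = trace (?B ** cadjoint X ** ?A ** Y ** ?S ** W)"
      by (rule trace_mul_sym)
    ultimately have "trace (?S ** W ** ?B ** cadjoint X ** ?A ** Y) = trace (?B ** cadjoint X ** ?A ** Y ** ?S ** W)"
      by (simp add: matrix_mul_assoc)
    then show "Re (trace (?B ** cadjoint X ** ?A ** 0 + (?B ** cadjoint X ** (?A ** W ** ?S + cadjoint ?S ** cadjoint W ** ?A)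
      + (?B ** 0 + (?S ** W ** ?B + ?B ** cadjoint W ** cadjoint ?S) ** cadjoint X) ** ?A) ** Y)) =
      Re (trace (?B ** cadjoint (bergman_christoffel Z W X) ** ?A ** Y)) +
      Re (trace (?B ** cadjoint X ** ?A ** bergman_christoffel Z W Y))"
      by (simp add: bergman_christoffel_def cadjoint_add cadjoint_mult matrix_mult_distribs
          matrix_mul_assoc trace_add)
  qed
qed

end

lemma bilinear_bergman_christoffel: "bilinear (bergman_christoffel Z)"
  unfolding bilinear_def bergman_christoffel_def linear_iff
  by (simp add: matrix_mult_distribs scalar_matrix_assoc[symmetric] matrix_scalar_ac algebra_simps)

lemma bergman_christoffel_has_derivative:
  assumes "det (gram Z) \<noteq> 0"
  shows "((\<lambda>Z. bergman_christoffel Z U V) has_derivative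
    (\<lambda>W. U ** connection_deriv Z W ** V + V ** connection_deriv Z W ** U)) (at Z)"
proof -
  have "((\<lambda>Z. U ** connection Z ** V) has_derivative
      (\<lambda>W. (U ** connection Z) ** 0 + (U ** connection_deriv Z W + 0 ** connection Z) ** V)) (at Z)" for U V
    by (rule matrix_mult_has_derivative[OF matrix_mult_has_derivative[OF has_derivative_const
            connection_has_derivative[OF assms]] has_derivative_const])
  then have 1: "((\<lambda>Z. U ** connection Z ** V) has_derivative (\<lambda>W. U ** connection_deriv Z W ** V)) (at Z)"
    for U V by simp
  show ?thesis unfolding bergman_christoffel_def by (rule has_derivative_add[OF 1 1])
qed

lemma bilinear_bergman_christoffel_deriv:
  "bilinear (\<lambda>U V. U ** connection_deriv Z W ** V + V ** connection_deriv Z W ** U)"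
  unfolding bilinear_def linear_iff
  by (simp add: matrix_mult_distribs scalar_matrix_assoc[symmetric] matrix_scalar_ac algebra_simps)

section \<open>Positivity of the trace form\<close>

lemma trace_cadjoint_mult:
  "trace (cadjoint X ** Y) = (\<Sum>p\<in>UNIV. cnj (X $ fst p $ snd p) * Y $ fst p $ snd p)"
proof -
  have "trace (cadjoint X ** Y) = (\<Sum>j\<in>UNIV. \<Sum>i\<in>UNIV. cnj (X $ i $ j) * Y $ i $ j)"
    by (simp add: trace_def matrix_matrix_mult_def)
  also have "\<dots> = (\<Sum>i\<in>UNIV. \<Sum>j\<in>UNIV. cnj (X $ i $ j) * Y $ i $ j)" by (rule sum.swap)
  also have "\<dots> = (\<Sum>p\<in>UNIV. cnj (X $ fst p $ snd p) * Y $ fst p $ snd p)"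
    by (simp add: sum.cartesian_product case_prod_unfold flip: UNIV_Times_UNIV)
  finally show ?thesis .
qed

lemma Re_trace_cadjoint_self: "Re (trace (cadjoint X ** X)) = (\<Sum>p\<in>UNIV. (cmod (X $ fst p $ snd p))\<^sup>2)"
proof -
  have "Re (cnj z * z) = (cmod z)\<^sup>2" for z
    unfolding cmod_power2 by (simp add: power2_eq_square)
  then show ?thesis by (simp only: trace_cadjoint_mult Re_sum)
qed

lemma Re_trace_cadjoint_self_nonneg: "Re (trace (cadjoint X ** X)) \<ge> 0"
  unfolding Re_trace_cadjoint_self by (rule sum_nonneg) simp

lemma Re_trace_cadjoint_self_eq_0: "Re (trace (cadjoint X ** X)) = 0 \<Longrightarrow> X = 0"
  unfolding Re_trace_cadjoint_self by (simp add: sum_nonneg_eq_0_iff vec_eq_iff)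

section \<open>Block matrices and the group action\<close>

lemma sum_UNIV_sum: "(\<Sum>i\<in>UNIV. f i) = (\<Sum>i\<in>UNIV. f (Inl i)) + (\<Sum>i\<in>UNIV. f (Inr i))"
  for f :: "'a::finite + 'b::finite \<Rightarrow> 'c::comm_monoid_add"
  by (simp add: sum.Plus flip: UNIV_Plus_UNIV)

lemma block_mult:
  "block11 (h ** k) = block11 h ** block11 k + block12 h ** block21 k"
  "block12 (h ** k) = block11 h ** block12 k + block12 h ** block22 k"
  "block21 (h ** k) = block21 h ** block11 k + block22 h ** block21 k"
  "block22 (h ** k) = block21 h ** block12 k + block22 h ** block22 k"
  by (simp_all add: vec_eq_iff matrix_matrix_mult_def sum_UNIV_sum block11_def block12_def block21_def block22_def)

lemma block_cadjoint:
  "block11 (cadjoint h) = cadjoint (block11 h)" "block12 (cadjoint h) = cadjoint (block21 h)"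
  "block21 (cadjoint h) = cadjoint (block12 h)" "block22 (cadjoint h) = cadjoint (block22 h)"
  by (simp_all add: vec_eq_iff block11_def block12_def block21_def block22_def)

lemma block_indef_form:
  "block11 indef_form = - mat 1" "block12 indef_form = 0" "block21 indef_form = 0" "block22 indef_form = mat 1"
  by (auto simp: vec_eq_iff block11_def block12_def block21_def block22_def indef_form_def mat_def)

lemma block_eqI:
  assumes "block11 h = block11 k" "block12 h = block12 k" "block21 h = block21 k" "block22 h = block22 k"
  shows "h = k"
proof -
  have "h $ i $ j = k $ i $ j" for i j
    using assms by (cases i; cases j) (auto simp: vec_eq_iff block11_def block12_def block21_def block22_def)
  then show ?thesis by (simp add: vec_eq_iff)
qed

lemma indef_form_square: "indef_form ** indef_form = mat 1"
  by (rule block_eqI) (simp_all only: block_mult block_indef_form matrix_mult_minus_left matrix_mult_minus_right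
      matrix_mul_lid matrix_mul_rid minus_minus times0_left times0_right add_0_left add_0_right,
      auto simp: vec_eq_iff block11_def block12_def block21_def block22_def mat_def)

text \<open>The first identity is a block of the defining equation. The other three are blocks of
  the same equation for \<open>cadjoint h\<close>: it holds because the defining equation gives a
  left inverse of h, which is also a right inverse.\<close>

lemma SU2m_blocks:
  assumes "h \<in> SU2m"
  shows "cadjoint (block11 h) ** block11 h = mat 1 + cadjoint (block21 h) ** block21 h"
    and "block12 h ** cadjoint (block12 h) = block11 h ** cadjoint (block11 h) - mat 1"
    and "block22 h ** cadjoint (block12 h) = block21 h ** cadjoint (block11 h)"
    and "block22 h ** cadjoint (block22 h) = mat 1 + block21 h ** cadjoint (block21 h)"
proof -
  let ?J = indef_form
  have 1: "cadjoint h ** ?J ** h = ?J" using assms by (simp add: SU2m_def)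
  have "(?J ** cadjoint h ** ?J) ** h = ?J ** (cadjoint h ** ?J ** h)" by (simp add: matrix_mul_assoc)
  also have "\<dots> = mat 1" by (simp only: 1 indef_form_square)
  finally have "h ** (?J ** cadjoint h ** ?J) = mat 1" using matrix_left_right_inverse by blast
  then have "h ** ?J ** cadjoint h ** (?J ** ?J) = ?J" by (simp add: matrix_mul_assoc)
  then have 2: "h ** ?J ** cadjoint h = ?J" by (simp add: indef_form_square)
  note simps = block_mult block_cadjoint block_indef_form matrix_mult_minus_right matrix_mult_minus_left
  show "cadjoint (block11 h) ** block11 h = mat 1 + cadjoint (block21 h) ** block21 h"
  proof -
    have "cadjoint (block21 h) ** block21 h - cadjoint (block11 h) ** block11 h = - mat 1"
      using arg_cong[OF 1, of block11] by (simp add: simps)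
    from arg_cong[OF this, of "\<lambda>t. cadjoint (block11 h) ** block11 h + t + mat 1"] show ?thesis
      by (simp add: add.commute)
  qed
  show "block12 h ** cadjoint (block12 h) = block11 h ** cadjoint (block11 h) - mat 1"
    using arg_cong[OF 2, of block11] by (simp add: simps algebra_simps)
  show "block22 h ** cadjoint (block12 h) = block21 h ** cadjoint (block11 h)"
    using arg_cong[OF 2, of block21] by (simp add: simps)
  show "block22 h ** cadjoint (block22 h) = mat 1 + block21 h ** cadjoint (block21 h)"
    using arg_cong[OF 2, of block22] by (simp add: simps algebra_simps)
qed

lemma det_block11_nonzero:
  assumes "h \<in> SU2m"
  shows "det (block11 h) \<noteq> 0"
proof -
  let ?a = "block11 h" and ?c = "block21 h"
  have "x = 0" if "?a *v x = 0" for x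
  proof -
    \<comment> \<open>The vector x is repeated as both columns, so that positivity of the trace form
      applies. Since \<open>cadjoint ?a ** ?a\<close> is the identity plus a positive semidefinite
      matrix, the kernel of \<open>?a\<close> is trivial.\<close>
    define X :: "complex^2^2" where "X = (\<chi> i j. x $ i)"
    have "?a ** X = 0"
      using that by (simp add: X_def vec_eq_iff matrix_matrix_mult_def matrix_vector_mult_def)
    then have "0 = cadjoint X ** (cadjoint ?a ** (?a ** X))" by simp
    also have "\<dots> = cadjoint X ** (cadjoint ?a ** ?a) ** X" by (simp only: matrix_mul_assoc)
    also have "\<dots> = cadjoint X ** X + cadjoint (?c ** X) ** (?c ** X)"
      unfolding SU2m_blocks(1)[OF assms] by (simp add: matrix_mult_distribs cadjoint_mult matrix_mul_assoc)
    finally have "Re (trace (cadjoint X ** X)) + Re (trace (cadjoint (?c ** X) ** (?c ** X))) = 0"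
      by (metis trace_add plus_complex.sel(1) trace_0 mat_0 zero_complex.sel(1))
    then have "Re (trace (cadjoint X ** X)) = 0"
      using Re_trace_cadjoint_self_nonneg[of X] Re_trace_cadjoint_self_nonneg[of "?c ** X"] by linarith
    then have "X = 0" by (rule Re_trace_cadjoint_self_eq_0)
    then show "x = 0" by (simp add: X_def vec_eq_iff)
  qed
  then have "\<exists>B. B ** ?a = mat 1" using matrix_left_invertible_ker by blast
  then show ?thesis using invertible_det_nz invertible_left_inverse by blast
qed

lemma act_0: "act h 0 = block21 h ** matrix_inv (block11 h)"
  by (simp add: act_def)

lemma act_deriv_0:
  assumes "det (block11 h) \<noteq> 0"
  shows "act_deriv h 0 X = (block22 h - act h 0 ** block12 h) ** X ** matrix_inv (block11 h)"
proof -
  let ?a = "block11 h" and ?b = "block12 h" and ?c = "block21 h" and ?d = "block22 h"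
  have lin: "((\<lambda>Z. A + B ** Z) has_derivative (\<lambda>X. B ** X)) (at 0)"
    for A :: "complex^2^'n::finite" and B :: "complex^'m^'n"
    using has_derivative_add[OF has_derivative_const
        matrix_mult_has_derivative[OF has_derivative_const has_derivative_ident]] by simp
  have "(matrix_inv has_derivative (\<lambda>H. - (matrix_inv ?a ** H ** matrix_inv ?a))) (at (?a + ?b ** 0))"
    using matrix_inv_has_derivative[OF assms] by simp
  from matrix_mult_has_derivative[OF lin has_derivative_compose[OF lin this]]
  have "(act h has_derivative (\<lambda>X. (?c + ?d ** 0) ** - (matrix_inv ?a ** (?b ** X) ** matrix_inv ?a)
     + (?d ** X) ** matrix_inv (?a + ?b ** 0))) (at 0)"
    unfolding act_def[abs_def] .
  from frechet_derivative_at[OF this, symmetric] show ?thesis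
    by (simp add: act_deriv_def act_0 matrix_mult_distribs matrix_mul_assoc)
qed

text \<open>With \<open>P P\<^sup>* = I - Z Z\<^sup>*\<close> and \<open>Q\<^sup>* Q = I - Z\<^sup>* Z\<close>, the derivative \<open>X \<mapsto> P X Q\<close> of the
  action is an isometry from the flat metric at the origin to the Bergman metric at \<open>Z\<close>.\<close>

lemma SU2m_frame:
  assumes h: "h \<in> SU2m" and Z: "Z = act h 0"
  obtains P Q P' Q' where "\<And>X. act_deriv h 0 X = P ** X ** Q" "P' ** P = mat 1" "P ** P' = mat 1"
    "Q ** Q' = mat 1" "Q' ** Q = mat 1" "det (gram Z) \<noteq> 0" "\<And>X. sharp Z (P ** X ** Q) = Q' ** cadjoint X ** P'"
proof -
  let ?a = "block11 h" and ?b = "block12 h" and ?c = "block21 h" and ?d = "block22 h"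
  define Q where "Q = matrix_inv ?a"
  define P where "P = ?d - Z ** ?b"
  note det = det_block11_nonzero[OF h]
  have a: "?a ** Q = mat 1" "Q ** ?a = mat 1" unfolding Q_def by (rule matrix_inv_mult[OF det])+
  then have a': "cadjoint Q ** cadjoint ?a = mat 1" "cadjoint ?a ** cadjoint Q = mat 1"
    by (simp_all flip: cadjoint_mult)
  have Zc: "Z = ?c ** Q" by (simp add: Z act_0 Q_def)
  have "gram Z = mat 1 - cadjoint Q ** (cadjoint ?c ** ?c) ** Q"
    by (simp add: gram_def Zc cadjoint_mult matrix_mul_assoc)
  also have "cadjoint ?c ** ?c = cadjoint ?a ** ?a - mat 1" using SU2m_blocks(1)[OF h] by simp
  also have "mat 1 - cadjoint Q ** (cadjoint ?a ** ?a - mat 1) ** Q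
      = mat 1 - (cadjoint Q ** cadjoint ?a) ** (?a ** Q) + cadjoint Q ** Q"
    by (simp add: matrix_mult_distribs matrix_mul_assoc)
  finally have gram: "gram Z = cadjoint Q ** Q" by (simp add: a a')
  have "gram Z ** (?a ** cadjoint ?a) = cadjoint Q ** (Q ** ?a) ** cadjoint ?a"
    by (simp add: gram matrix_mul_assoc)
  then have inv: "gram Z ** (?a ** cadjoint ?a) = mat 1" by (simp add: a a')
  then have gram_inv: "gram_inv Z = ?a ** cadjoint ?a" unfolding gram_inv_def by (rule matrix_inverse_unique)
  have detZ: "det (gram Z) \<noteq> 0" using det_nonzero_if_inverse[OF inv] .
  \<comment> \<open>\<open>e1\<close>, \<open>e2\<close> and \<open>e3\<close> evaluate the terms of
    \<open>P ** cadjoint P\<close>: the products of \<open>?c\<close> with its adjoint appear twice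
    with each sign and cancel.\<close>
  have e1: "Z ** ?b ** cadjoint ?d = ?c ** cadjoint ?c"
  proof -
    have "?b ** cadjoint ?d = ?a ** cadjoint ?c"
      using arg_cong[OF SU2m_blocks(3)[OF h], of cadjoint] by (simp add: cadjoint_mult)
    then have "Z ** (?b ** cadjoint ?d) = ?c ** (Q ** ?a) ** cadjoint ?c" by (simp add: Zc matrix_mul_assoc)
    then show ?thesis by (simp add: a matrix_mul_assoc)
  qed
  have e2: "?d ** cadjoint ?b ** cadjoint Z = ?c ** cadjoint ?c"
    using arg_cong[OF e1, of cadjoint] by (simp add: cadjoint_mult matrix_mul_assoc)
  have e3: "Z ** (?b ** cadjoint ?b) ** cadjoint Z = ?c ** cadjoint ?c - Z ** cadjoint Z"
  proof -
    have "Z ** (?b ** cadjoint ?b) ** cadjoint Z = ?c ** (Q ** ?a) ** (cadjoint ?a ** cadjoint Q) ** cadjoint ?c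
       - Z ** cadjoint Z"
      unfolding SU2m_blocks(2)[OF h] by (simp add: Zc cadjoint_mult matrix_mult_distribs matrix_mul_assoc)
    then show ?thesis by (simp add: a a')
  qed
  have "P ** cadjoint P = ?d ** cadjoint ?d - Z ** ?b ** cadjoint ?d - ?d ** cadjoint ?b ** cadjoint Z
      + Z ** (?b ** cadjoint ?b) ** cadjoint Z"
    by (simp add: P_def cadjoint_diff cadjoint_mult matrix_mult_distribs matrix_mul_assoc algebra_simps)
  then have PP: "P ** cadjoint P = mat 1 - Z ** cadjoint Z"
    unfolding e1 e2 e3 SU2m_blocks(4)[OF h] by simp
  \<comment> \<open>This confirms that \<open>cogram_inv\<close> is the inverse its name announces:
    \<open>gram Z ** gram_inv Z\<close> is the identity, so the last two summands cancel.\<close>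
  have "(mat 1 - Z ** cadjoint Z) ** cogram_inv Z
      = mat 1 - Z ** cadjoint Z + Z ** (gram Z ** gram_inv Z) ** cadjoint Z"
    by (simp add: cogram_inv_def gram_def matrix_mult_distribs matrix_mul_assoc algebra_simps)
  then have "P ** (cadjoint P ** cogram_inv Z) = mat 1"
    by (simp add: gram_inv_mult[OF detZ] PP matrix_mul_assoc)
  moreover from this have "(cadjoint P ** cogram_inv Z) ** P = mat 1" using matrix_left_right_inverse by blast
  moreover have "sharp Z (P ** X ** Q) = ?a ** cadjoint X ** (cadjoint P ** cogram_inv Z)" for X
  proof -
    have "sharp Z (P ** X ** Q) = ?a ** (cadjoint ?a ** cadjoint Q) ** cadjoint X ** (cadjoint P ** cogram_inv Z)"
      by (simp add: sharp_def gram_inv cadjoint_mult matrix_mul_assoc)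
    then show ?thesis by (simp add: a')
  qed
  moreover have "act_deriv h 0 X = P ** X ** Q" for X
    unfolding act_deriv_0[OF det] by (simp add: P_def Q_def Z)
  ultimately show thesis using that[of P Q "cadjoint P ** cogram_inv Z" ?a] a detZ by blast
qed

section \<open>Invariant metrics\<close>

definition block_diag :: "complex^2^2 \<Rightarrow> complex^'m^'m \<Rightarrow> complex^(2 + 'm::finite)^(2 + 'm)" where
  "block_diag a d = (\<chi> i j. case i of
     Inl i' \<Rightarrow> (case j of Inl j' \<Rightarrow> a $ i' $ j' | Inr j' \<Rightarrow> 0)
   | Inr i' \<Rightarrow> (case j of Inl j' \<Rightarrow> 0 | Inr j' \<Rightarrow> d $ i' $ j'))"

lemma block_block_diag [simp]:
  "block11 (block_diag a d) = a" "block12 (block_diag a d) = 0"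
  "block21 (block_diag a d) = 0" "block22 (block_diag a d) = d"
  by (simp_all add: vec_eq_iff block_diag_def block11_def block12_def block21_def block22_def)

lemma det_cadjoint: "det (cadjoint A) = cnj (det A)"
proof -
  have "det (cadjoint A) = det (transpose (\<chi> i j. cnj (A $ i $ j)))"
    by (rule arg_cong[where f=det]) (simp add: vec_eq_iff transpose_def)
  also have "\<dots> = cnj (det A)" unfolding det_transpose by (simp add: det_def)
  finally show ?thesis .
qed

text \<open>A block diagonal unitary matrix preserves the form, but its determinant is only known to
  have modulus 1. A scalar factor repairs this and does not change the action. The upper block is
  \<open>cadjoint V\<close> because the action inverts it.\<close>

lemma unitary_in_SU2m:
  fixes U :: "complex^'m::finite^'m" and V :: "complex^2^2"
  assumes U: "cadjoint U ** U = mat 1" and V: "cadjoint V ** V = mat 1"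
  obtains h where "h \<in> SU2m" "act h 0 = 0" "\<And>X. act_deriv h 0 X = U ** X ** V"
proof -
  let ?J = "indef_form :: complex^(2 + 'm)^(2 + 'm)"
  have V': "V ** cadjoint V = mat 1" using V matrix_left_right_inverse by blast
  have form: "cadjoint (block_diag a d) ** ?J ** block_diag a d = ?J"
    if "cadjoint a ** a = mat 1" "cadjoint d ** d = mat 1" for a d
    by (rule block_eqI) (simp_all add: block_mult block_cadjoint block_indef_form that
        matrix_mult_minus_left matrix_mult_minus_right)
  define h\<^sub>0 where "h\<^sub>0 = block_diag (cadjoint V) U"
  have "det ?J \<noteq> 0" using det_nonzero_if_inverse[OF indef_form_square] .
  moreover have "cadjoint h\<^sub>0 ** ?J ** h\<^sub>0 = ?J" unfolding h\<^sub>0_def by (rule form) (simp_all add: U V')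
  then have "cnj (det h\<^sub>0) * det ?J * det h\<^sub>0 = det ?J" by (metis det_mul det_cadjoint)
  ultimately have "cnj (det h\<^sub>0) * det h\<^sub>0 = 1" by (simp add: field_simps)
  then have "(cmod (det h\<^sub>0))\<^sup>2 = 1" by (metis complex_norm_square mult.commute of_real_1 of_real_eq_iff)
  then have norm1: "cmod (det h\<^sub>0) = 1" using norm_ge_zero[of "det h\<^sub>0"] unfolding power2_eq_1_iff by linarith
  define n where "n = CARD(2 + 'm)"
  \<comment> \<open>The angle is divided by the size n of the matrix, so that \<open>l ^ n\<close>
    is the inverse of the determinant.\<close>
  define l where "l = cis (- Arg (det h\<^sub>0) / n)"
  have "n > 0" unfolding n_def by (rule zero_less_card_finite)
  then have "l ^ n = cis (- Arg (det h\<^sub>0))" by (simp add: l_def Complex.DeMoivre)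
  moreover have "det h\<^sub>0 = cis (Arg (det h\<^sub>0))"
  proof -
    have "det h\<^sub>0 \<noteq> 0" using norm1 by force
    then show ?thesis using cis_Arg[of "det h\<^sub>0"] norm1 by (simp add: sgn_eq)
  qed
  ultimately have ln: "l ^ n * det h\<^sub>0 = 1" by (metis add.left_inverse cis_mult cis_zero)
  have ll: "cnj l * l = 1" "l * cnj l = 1" by (simp_all add: l_def cis_cnj cis_mult)
  have matl: "mat (cnj l) ** (mat l :: complex^'n::finite^'n) = mat 1"
    if "cnj l * l = 1" for l
    using that by (simp add: vec_eq_iff) (simp add: mat_def)
  define h where "h = block_diag (mat l ** cadjoint V) (mat l ** U)"
  have hl: "h = mat l ** h\<^sub>0"
    by (simp add: h_def h\<^sub>0_def vec_eq_iff block_diag_def split: sum.split)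
  have "cadjoint (mat l ** U) ** (mat l ** U) = cadjoint U ** (mat (cnj l) ** mat l) ** U"
    "cadjoint (mat l ** cadjoint V) ** (mat l ** cadjoint V) = V ** (mat (cnj l) ** mat l) ** cadjoint V"
    by (simp_all add: cadjoint_mult matrix_mul_assoc)
  then have "cadjoint h ** ?J ** h = ?J"
    unfolding h_def by (intro form) (simp_all add: matl[OF ll(1)] U V')
  moreover have "det h = 1"
    unfolding hl det_mul using ln by (simp add: det_diagonal mat_def n_def)
  ultimately have "h \<in> SU2m" by (simp add: SU2m_def)
  moreover have "act h 0 = 0" by (simp add: act_0 h_def)
  moreover have "act_deriv h 0 X = U ** X ** V" for X
  proof -
    have "(mat l ** cadjoint V) ** (V ** mat (cnj l)) = mat l ** (cadjoint V ** V) ** mat (cnj l)"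
      by (simp add: matrix_mul_assoc)
    then have "(mat l ** cadjoint V) ** (V ** mat (cnj l)) = mat 1"
      using matl[of "cnj l"] ll by (simp add: V)
    then have "matrix_inv (block11 h) = V ** mat (cnj l)"
      unfolding h_def block_block_diag by (rule matrix_inverse_unique)
    then have "act_deriv h 0 X = mat l ** U ** X ** (V ** mat (cnj l))"
      unfolding act_deriv_0[OF det_block11_nonzero[OF \<open>h \<in> SU2m\<close>]] by (simp add: h_def)
    then show ?thesis using ll by (simp add: vec_eq_iff matrix_mul_assoc[symmetric]) (simp add: matrix_mul_assoc)
  qed
  ultimately show thesis by (rule that)
qed

definition matrix_unit :: "'m \<Rightarrow> 'n \<Rightarrow> complex \<Rightarrow> complex^'n^'m" where
  "matrix_unit i j z = (\<chi> k l. if k = i \<and> l = j then z else 0)"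

definition sign_matrix :: "'n \<Rightarrow> complex^'n^'n" where
  "sign_matrix i = (\<chi> k l. if k = l then if k = i then - 1 else 1 else 0)"

definition swap_matrix :: "'n \<Rightarrow> 'n \<Rightarrow> complex^'n^'n" where
  "swap_matrix i j = (\<chi> k l. if l = Transposition.transpose i j k then 1 else 0)"

lemma sign_matrix_mult_nth:
  fixes A :: "complex^'n::finite^'m::finite"
  shows "(sign_matrix i ** A) $ k $ l = (if k = i then - A $ k $ l else A $ k $ l)"
    and "(A ** sign_matrix j) $ k $ l = (if l = j then - A $ k $ l else A $ k $ l)"
  by (simp_all add: sign_matrix_def matrix_matrix_mult_def if_distrib[of "\<lambda>x. x * _"] if_distrib[of "\<lambda>x. _ * x"] cong: if_cong)

lemma swap_matrix_mult_nth:
  fixes A :: "complex^'n::finite^'m::finite"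
  shows "(swap_matrix i i' ** A) $ k $ l = A $ Transposition.transpose i i' k $ l"
    and "(A ** swap_matrix j j') $ k $ l = A $ k $ Transposition.transpose j j' l"
proof -
  show "(swap_matrix i i' ** A) $ k $ l = A $ Transposition.transpose i i' k $ l"
    by (simp add: swap_matrix_def matrix_matrix_mult_def if_distrib[of "\<lambda>x. x * _"] cong: if_cong)
  have "l = Transposition.transpose j j' r \<longleftrightarrow> r = Transposition.transpose j j' l" for r
    by auto
  then show "(A ** swap_matrix j j') $ k $ l = A $ k $ Transposition.transpose j j' l"
    by (simp add: swap_matrix_def matrix_matrix_mult_def if_distrib[of "\<lambda>x. _ * x"] cong: if_cong)
qed

lemma sign_matrix_unitary: "cadjoint (sign_matrix i) ** sign_matrix i = mat 1"
  by (simp add: vec_eq_iff sign_matrix_mult_nth) (simp add: sign_matrix_def mat_def)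

lemma swap_matrix_unitary: "cadjoint (swap_matrix i j) ** swap_matrix i j = mat 1"
proof -
  have "Transposition.transpose i j l = k \<longleftrightarrow> k = Transposition.transpose i j l" for k l by auto
  then show ?thesis by (auto simp: vec_eq_iff swap_matrix_mult_nth) (auto simp: swap_matrix_def mat_def)
qed

text \<open>Schur's lemma for \<open>U(m) \<times> U(2)\<close> acting on matrices; diagonal sign matrices, transpositions and
  multiplication by \<open>\<i>\<close> are enough.\<close>

lemma unitary_invariant_form:
  fixes \<beta> :: "complex^'n::finite^'m::finite \<Rightarrow> complex^'n^'m \<Rightarrow> real"
  assumes bil: "bilinear \<beta>" and sym: "\<And>X Y. \<beta> X Y = \<beta> Y X"
    and inv: "\<And>U V X Y. cadjoint U ** U = mat 1 \<Longrightarrow> cadjoint V ** V = mat 1 \<Longrightarrow>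
      \<beta> (U ** X ** V) (U ** Y ** V) = \<beta> X Y"
  obtains c where "\<And>X Y. \<beta> X Y = c * Re (trace (cadjoint X ** Y))"
proof -
  have one: "cadjoint (mat 1) ** mat 1 = (mat 1 :: complex^'k::finite^'k)" by simp
  have left: "\<beta> (U ** X) (U ** Y) = \<beta> X Y" if "cadjoint U ** U = mat 1" for U X Y
    using inv[OF that one, of X Y] by simp
  have right: "\<beta> (X ** V) (Y ** V) = \<beta> X Y" if "cadjoint V ** V = mat 1" for V X Y
    using inv[OF one that, of X Y] by simp
  let ?E = "matrix_unit :: 'm \<Rightarrow> 'n \<Rightarrow> complex \<Rightarrow> complex^'n^'m"
  note lneg = bilinear_lneg[OF bil] and rneg = bilinear_rneg[OF bil]
  \<comment> \<open>Changing the sign of row i negates one argument and fixes the other, so the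
    value equals its own negative; \<open>off2\<close> does the same with columns.\<close>
  have off1: "\<beta> (?E i j z) (?E k l w) = 0" if "i \<noteq> k" for i j k l z w
  proof -
    have "sign_matrix i ** ?E i j z = - ?E i j z" "sign_matrix i ** ?E k l w = ?E k l w"
      using that by (auto simp: vec_eq_iff sign_matrix_mult_nth) (auto simp: matrix_unit_def)
    then show ?thesis
      using left[OF sign_matrix_unitary, of i "?E i j z" "?E k l w"] by (simp add: lneg)
  qed
  have off2: "\<beta> (?E i j z) (?E k l w) = 0" if "j \<noteq> l" for i j k l z w
  proof -
    have "?E i j z ** sign_matrix j = - ?E i j z" "?E k l w ** sign_matrix j = ?E k l w"
      using that by (auto simp: vec_eq_iff sign_matrix_mult_nth) (auto simp: matrix_unit_def)
    then show ?thesis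
      using right[OF sign_matrix_unitary, of "?E i j z" j "?E k l w"] by (simp add: lneg)
  qed
  have diag: "\<beta> (?E i j 1) (?E i j 1) = \<beta> (?E i' j' 1) (?E i' j' 1)" for i j i' j'
  proof -
    have "Transposition.transpose a b r = b \<longleftrightarrow> r = a" for a b r :: 'k by (auto simp: Transposition.transpose_def)
    then have "swap_matrix i i' ** ?E i' j 1 = ?E i j 1" "?E i' j' 1 ** swap_matrix j j' = ?E i' j 1"
      by (auto simp: vec_eq_iff swap_matrix_mult_nth matrix_unit_def Transposition.transpose_def)
    then show ?thesis
      using left[OF swap_matrix_unitary, of i i' "?E i' j 1" "?E i' j 1"]
        right[OF swap_matrix_unitary, of "?E i' j' 1" j j' "?E i' j' 1"] by simp
  qed
  fix i\<^sub>0 :: 'm and j\<^sub>0 :: 'n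
  define c where "c = \<beta> (?E i\<^sub>0 j\<^sub>0 1) (?E i\<^sub>0 j\<^sub>0 1)"
  \<comment> \<open>Invariance under multiplication by \<i>, together with symmetry, makes the units
    with entries 1 and \<i> orthogonal and of equal square \<open>c\<close>; real bilinearity gives
    the rest.\<close>
  have on: "\<beta> (?E i j z) (?E i j w) = c * Re (cnj z * w)" for i j z w
  proof -
    have i: "cadjoint (mat \<i>) ** mat \<i> = (mat 1 :: complex^'m^'m)"
      by (simp add: vec_eq_iff) (simp add: mat_def)
    have "mat \<i> ** ?E i j 1 = ?E i j \<i>" "mat \<i> ** ?E i j \<i> = - ?E i j 1"
      by (simp_all add: vec_eq_iff) (simp_all add: matrix_unit_def)
    then have "\<beta> (?E i j \<i>) (- ?E i j 1) = \<beta> (?E i j 1) (?E i j \<i>)"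
      "\<beta> (?E i j \<i>) (?E i j \<i>) = \<beta> (?E i j 1) (?E i j 1)"
      using left[OF i, of "?E i j 1" "?E i j \<i>"] left[OF i, of "?E i j 1" "?E i j 1"] by simp_all
    then have *: "\<beta> (?E i j 1) (?E i j \<i>) = 0" "\<beta> (?E i j \<i>) (?E i j 1) = 0" "\<beta> (?E i j \<i>) (?E i j \<i>) = c"
      "\<beta> (?E i j 1) (?E i j 1) = c"
      using sym[of "?E i j 1" "?E i j \<i>"] diag[of i j i\<^sub>0 j\<^sub>0] by (simp_all add: rneg c_def)
    have E: "?E i j z = Re z *\<^sub>R ?E i j 1 + Im z *\<^sub>R ?E i j \<i>" for z
      by (auto simp: vec_eq_iff matrix_unit_def complex_eq_iff)
    have "\<beta> (?E i j z) (?E i j w) = (Re z * Re w + Im z * Im w) * c"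
      unfolding E[of z] E[of w]
      by (simp add: bilinear_ladd[OF bil] bilinear_radd[OF bil] bilinear_lmul[OF bil] bilinear_rmul[OF bil] *
          algebra_simps)
    then show ?thesis by (simp add: mult.commute)
  qed
  have ex: "X = (\<Sum>p\<in>UNIV. ?E (fst p) (snd p) (X $ fst p $ snd p))" for X
  proof -
    have "(\<Sum>p\<in>UNIV. ?E (fst p) (snd p) (X $ fst p $ snd p)) $ k $ l = X $ k $ l" for k l
    proof -
      have "(\<Sum>p\<in>UNIV. ?E (fst p) (snd p) (X $ fst p $ snd p)) $ k $ l
          = (\<Sum>p\<in>UNIV. if p = (k, l) then X $ k $ l else 0)"
        unfolding sum_component by (rule sum.cong) (auto simp: matrix_unit_def)
      then show ?thesis by simp
    qed
    then show ?thesis by (simp add: vec_eq_iff)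
  qed
  show thesis
  proof (rule that)
    fix X Y
    have "\<beta> X Y = \<beta> (\<Sum>p\<in>UNIV. ?E (fst p) (snd p) (X $ fst p $ snd p))
        (\<Sum>q\<in>UNIV. ?E (fst q) (snd q) (Y $ fst q $ snd q))"
      by (simp only: ex[symmetric])
    also have "\<dots> = (\<Sum>(p, q)\<in>UNIV \<times> UNIV. \<beta> (?E (fst p) (snd p) (X $ fst p $ snd p))
        (?E (fst q) (snd q) (Y $ fst q $ snd q)))"
      by (rule bilinear_sum[OF bil])
    also have "\<dots> = (\<Sum>p\<in>UNIV. \<Sum>q\<in>UNIV. \<beta> (?E (fst p) (snd p) (X $ fst p $ snd p))
        (?E (fst q) (snd q) (Y $ fst q $ snd q)))"
      by (rule sum.cartesian_product[symmetric])
    also have "\<dots> = (\<Sum>p\<in>UNIV. \<Sum>q\<in>UNIV. if q = p then c * Re (cnj (X $ fst p $ snd p) * Y $ fst p $ snd p) else 0)"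
    proof (intro sum.cong refl)
      fix p q :: "'m \<times> 'n"
      show "\<beta> (?E (fst p) (snd p) (X $ fst p $ snd p)) (?E (fst q) (snd q) (Y $ fst q $ snd q))
        = (if q = p then c * Re (cnj (X $ fst p $ snd p) * Y $ fst p $ snd p) else 0)"
        using on off1[of "fst p" "fst q"] off2[of "snd p" "snd q"]
        by (cases "q = p") (auto simp: prod_eq_iff)
    qed
    also have "\<dots> = c * Re (trace (cadjoint X ** Y))"
      unfolding trace_cadjoint_mult Re_sum sum_distrib_left by (simp only: sum.delta finite UNIV_I if_True)
    finally show "\<beta> X Y = c * Re (trace (cadjoint X ** Y))" .
  qed
qed

lemma grassmannian_frame:
  assumes "Z \<in> grassmannian"
  obtains h P Q P' Q' where "h \<in> SU2m" "act h 0 = Z" "\<And>X. act_deriv h 0 X = P ** X ** Q"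
    "P' ** P = mat 1" "P ** P' = mat 1" "Q ** Q' = mat 1" "Q' ** Q = mat 1"
    "det (gram Z) \<noteq> 0" "\<And>X. sharp Z (P ** X ** Q) = Q' ** cadjoint X ** P'"
proof -
  obtain h where h: "h \<in> SU2m" "Z = act h 0" using assms unfolding grassmannian_def by blast
  show thesis by (rule SU2m_frame[OF h]) (rule that[OF h(1) h(2)[symmetric]])
qed

lemma bergman_frame:
  assumes "P' ** P = mat 1" "Q ** Q' = mat 1" "\<And>X. sharp Z (P ** X ** Q) = Q' ** cadjoint X ** P'"
  shows "bergman Z (P ** X ** Q) (P ** Y ** Q) = Re (trace (cadjoint X ** Y))"
proof -
  have "bergman Z (P ** X ** Q) (P ** Y ** Q) = Re (trace (Q' ** (cadjoint X ** (P' ** P) ** Y ** Q)))"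
    by (simp add: bergman_def assms(3) matrix_mul_assoc)
  also have "\<dots> = Re (trace (cadjoint X ** (P' ** P) ** Y ** Q ** Q'))" by (subst trace_mul_sym) simp
  also have "\<dots> = Re (trace (cadjoint X ** Y ** (Q ** Q')))" by (simp add: assms(1) matrix_mul_assoc)
  finally show ?thesis by (simp add: assms(2))
qed

text \<open>At the origin the metric is invariant under the isotropy group, so
  \<open>unitary_invariant_form\<close> makes it a multiple of the trace form. Any h with
  \<open>act h 0 = Z\<close> carries g at the origin to g at Z and the trace form to
  \<open>bergman Z\<close>, with the same factor.\<close>

lemma invariant_metric_eq_bergman:
  fixes g :: "complex^2^'m::finite \<Rightarrow> complex^2^'m \<Rightarrow> complex^2^'m \<Rightarrow> real"
  assumes g: "invariant_metric g"
  obtains c where "\<And>Z X Y. Z \<in> grassmannian \<Longrightarrow> g Z X Y = c * bergman Z X Y"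
proof -
  have inv: "g (act h 0) (act_deriv h 0 X) (act_deriv h 0 Y) = g 0 X Y" if "h \<in> SU2m" "(0 :: complex^2^'m) \<in> grassmannian" for h X Y
    using g that unfolding invariant_metric_def by blast
  have one: "cadjoint (mat 1) ** mat 1 = (mat 1 :: complex^'k::finite^'k)" by simp
  obtain e where "e \<in> SU2m" "act e 0 = (0 :: complex^2^'m)"
    using unitary_in_SU2m[OF one one] .
  then have 0: "(0 :: complex^2^'m) \<in> grassmannian" unfolding grassmannian_def by (metis (mono_tags, lifting) mem_Collect_eq)
  have bil: "bilinear (g 0)" and sym: "\<And>X Y. g 0 X Y = g 0 Y X"
    using g 0 unfolding invariant_metric_def by blast+
  have "g 0 (U ** X ** V) (U ** Y ** V) = g 0 X Y"
    if UV: "cadjoint U ** U = mat 1" "cadjoint V ** V = mat 1" for U V X Y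
  proof -
    obtain h where "h \<in> SU2m" "act h 0 = (0 :: complex^2^'m)" "\<And>X. act_deriv h 0 X = U ** X ** V"
      using unitary_in_SU2m[OF UV] by blast
    then show ?thesis using inv[of h X Y] 0 by simp
  qed
  then obtain c where c: "\<And>X Y. g 0 X Y = c * Re (trace (cadjoint X ** Y))"
    using unitary_invariant_form[OF bil sym] by blast
  show thesis
  proof (rule that)
    fix Z X Y :: "complex^2^'m" assume "Z \<in> grassmannian"
    then obtain h P Q P' Q' where h: "h \<in> SU2m" "act h 0 = Z" "\<And>X. act_deriv h 0 X = P ** X ** Q"
      "P' ** P = mat 1" "P ** P' = mat 1" "Q ** Q' = mat 1" "Q' ** Q = mat 1"
      "det (gram Z) \<noteq> 0" "\<And>X. sharp Z (P ** X ** Q) = Q' ** cadjoint X ** P'"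
      using grassmannian_frame by blast
    have frame: "P ** (P' ** X ** Q') ** Q = X" for X
    proof -
      have "P ** (P' ** X ** Q') ** Q = (P ** P') ** X ** (Q' ** Q)" by (simp only: matrix_mul_assoc)
      then show ?thesis by (simp add: h(5,7))
    qed
    have "g Z (P ** X ** Q) (P ** Y ** Q) = c * bergman Z (P ** X ** Q) (P ** Y ** Q)" for X Y
      using inv[OF h(1) 0, of X Y] unfolding h(2,3) c bergman_frame[OF h(4,6,9)] .
    from this[of "P' ** X ** Q'" "P' ** Y ** Q'"] show "g Z X Y = c * bergman Z X Y"
      by (simp only: frame)
  qed
qed

text \<open>The left side is the expression in \<open>umbilical_codazzi\<close>. The complex linear
  parts of \<open>connection_deriv\<close> cancel exactly against the iterated Christoffel forms,
  which leaves only the terms with \<open>sharp\<close>.\<close>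

lemma bergman_curvature:
  "(U ** connection_deriv Z W ** V + V ** connection_deriv Z W ** U)
    - (W ** connection_deriv Z U ** V + V ** connection_deriv Z U ** W)
    - bergman_christoffel Z U (bergman_christoffel Z W V)
    + bergman_christoffel Z W (bergman_christoffel Z U V)
    = U ** sharp Z W ** V + V ** sharp Z W ** U - W ** sharp Z U ** V - V ** sharp Z U ** W"
  by (simp add: connection_deriv_def bergman_christoffel_def matrix_mult_distribs matrix_mul_assoc algebra_simps)

lemma sharp_mat: "sharp Z (mat c ** X) = mat (cnj c) ** sharp Z X"
  unfolding sharp_def cadjoint_mult cadjoint_mat
  by (simp add: mat_mult_commute[of "cnj c"] matrix_mul_assoc[symmetric])

lemma bergman_kaehler: "bergman Z (mat \<i> ** X) Y = - bergman Z X (mat \<i> ** Y)"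
proof -
  have "mat (- \<i>) ** sharp Z X ** Y = - (mat \<i> ** (sharp Z X ** Y))"
    unfolding matrix_mul_assoc[symmetric] by (simp add: vec_eq_iff)
  also have "mat \<i> ** (sharp Z X ** Y) = sharp Z X ** (mat \<i> ** Y)"
    by (simp only: mat_mult_commute matrix_mul_assoc[symmetric])
  finally have "mat (- \<i>) ** sharp Z X ** Y = - (sharp Z X ** (mat \<i> ** Y))" .
  then show ?thesis
    by (simp add: bergman_def sharp_mat linear_neg[OF bounded_linear.linear[OF bounded_linear_trace]])
qed

lemma hypersurface_bergman:
  fixes g :: "complex^2^'m::finite \<Rightarrow> complex^2^'m \<Rightarrow> complex^2^'m \<Rightarrow> real"
  assumes g: "invariant_metric g" and M: "real_hypersurface TYPE('k::finite) M" and N: "unit_normal_field g M N"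
  shows "hypersurface TYPE('k) grassmannian g bergman_christoffel M N"
proof
  obtain c where c: "\<And>Z X Y. Z \<in> grassmannian \<Longrightarrow> g Z X Y = c * bergman Z X Y"
    using invariant_metric_eq_bergman[OF g] by blast
  fix Z u v :: "complex^2^'m"
  show smooth: "smooth_on grassmannian (\<lambda>q. g q u v)" using g by (simp add: invariant_metric_def)
  show "bilinear (bergman_christoffel Z)" by (rule bilinear_bergman_christoffel)
  show "bergman_christoffel Z u v = bergman_christoffel Z v u" by (simp add: bergman_christoffel_def add.commute)
  assume Z: "Z \<in> grassmannian"
  show "bilinear (g Z)" "g Z u v = g Z v u" "u \<noteq> 0 \<Longrightarrow> g Z u u > 0"
    using g Z unfolding invariant_metric_def by blast+
  have "det (gram Z) \<noteq> 0" using grassmannian_frame[OF Z] by metis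
  \<comment> \<open>Compatibility is linear in the metric, so a constant multiple of the Bergman
    metric has the same Christoffel form.\<close>
  from has_derivative_mult_right[OF bergman_has_derivative[OF this], of c]
  have "((\<lambda>q. c * bergman q u v) has_derivative (\<lambda>w. g Z (bergman_christoffel Z w u) v
       + g Z u (bergman_christoffel Z w v))) (at Z)"
    by (rule has_derivative_eq_rhs) (simp add: c[OF Z] algebra_simps)
  then show "((\<lambda>q. g q u v) has_derivative (\<lambda>w. g Z (bergman_christoffel Z w u) v
       + g Z u (bergman_christoffel Z w v))) (at Z)"
    by (rule has_derivative_transform_within_open[of _ _ _ _ grassmannian])
      (use smooth Z c in \<open>auto simp: smooth_on_def\<close>)
qed (use M N in \<open>auto simp: real_hypersurface_def\<close>)

text \<open>The witness \<open>w\<close> has a single nonzero column \<open>x\<close>, orthogonal to the same column \<open>n\<^sub>j\<close> of \<open>n\<close>;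
  then \<open>w w\<^sup>* n + n w\<^sup>* w\<close> has \<open>j\<close>-th column \<open>|x|\<^sup>2 n\<^sub>j\<close>, which is not a multiple of \<open>x\<close>.\<close>

lemma curvature_not_proportional:
  fixes n :: "complex^'n::finite^'m::finite"
  assumes m: "CARD('m) \<ge> 2" and n: "n \<noteq> 0"
  obtains w where "w \<noteq> 0" "trace (cadjoint n ** w) = 0"
    "\<And>\<zeta>. w ** cadjoint w ** n + n ** cadjoint w ** w \<noteq> mat \<zeta> ** w"
proof -
  obtain i j where ij: "n $ i $ j \<noteq> 0" using n by (auto simp: vec_eq_iff)
  have "\<exists>k. k \<noteq> i"
  proof (rule ccontr)
    assume "\<not> (\<exists>k. k \<noteq> i)"
    then have "UNIV = {i}" by auto
    then have "CARD('m) = card {i}" by simp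
    then show False using m by simp
  qed
  then obtain k where k: "k \<noteq> i" by blast
  \<comment> \<open>Entries i and k of column j of n are conjugated and interchanged, one with a
    sign: the orthogonal vector in a complex plane. Entry k is nonzero because
    \<open>n $ i $ j\<close> is; this is why a second row is required.\<close>
  define x :: "'m \<Rightarrow> complex" where
    "x r = (if r = i then cnj (n $ k $ j) else 0) + (if r = k then - cnj (n $ i $ j) else 0)" for r
  define w where "w = (\<chi> r l. if l = j then x r else 0)"
  have w: "w $ r $ l = (if l = j then x r else 0)" for r l by (simp add: w_def)
  have orth: "(\<Sum>r\<in>UNIV. cnj (x r) * n $ r $ j) = 0"
  proof -
    have "(\<Sum>r\<in>UNIV. cnj (x r) * n $ r $ j) = (\<Sum>r\<in>UNIV. if r = i then n $ k $ j * n $ i $ j else 0)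
        - (\<Sum>r\<in>UNIV. if r = k then n $ i $ j * n $ k $ j else 0)"
      unfolding sum_subtractf[symmetric] by (rule sum.cong) (auto simp: x_def)
    then show ?thesis by simp
  qed
  have xk: "x k \<noteq> 0" using k ij by (simp add: x_def)
  define S where "S = (\<Sum>r\<in>UNIV. cnj (x r) * x r)"
  have S: "S \<noteq> 0"
  proof
    assume "S = 0"
    then have "(\<Sum>r\<in>UNIV. Re (cnj (x r) * x r)) = 0" unfolding S_def by (metis Re_sum zero_complex.sel(1))
    moreover have "Re (cnj (x r) * x r) = (cmod (x r))\<^sup>2" for r
      unfolding cmod_power2 by (simp add: power2_eq_square)
    ultimately have "(\<Sum>r\<in>UNIV. (cmod (x r))\<^sup>2) = 0" by simp
    then show False using xk by (simp add: sum_nonneg_eq_0_iff)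
  qed
  show thesis
  proof (rule that[of w])
    show "w \<noteq> 0" using xk w[of k j] by auto
    have "trace (cadjoint w ** n) = (\<Sum>l\<in>UNIV. if l = j then (\<Sum>r\<in>UNIV. cnj (x r) * n $ r $ j) else 0)"
      unfolding trace_def by (rule sum.cong) (auto simp: matrix_matrix_mult_def w)
    then have "trace (cadjoint w ** n) = 0" by (simp add: orth)
    moreover have "trace (cadjoint n ** w) = cnj (trace (cadjoint w ** n))"
      by (simp add: trace_cadjoint_mult mult.commute)
    ultimately show "trace (cadjoint n ** w) = 0" by simp
    fix \<zeta>
    show "w ** cadjoint w ** n + n ** cadjoint w ** w \<noteq> mat \<zeta> ** w"
    proof
      assume eq: "w ** cadjoint w ** n + n ** cadjoint w ** w = mat \<zeta> ** w"
      have "(w ** (cadjoint w ** n)) $ r $ j = (\<Sum>l\<in>UNIV. if l = j then x r * (cadjoint w ** n) $ j $ j else 0)" for r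
        unfolding matrix_matrix_mult_def[of w] vec_lambda_beta by (rule sum.cong) (auto simp: w)
      moreover have "(cadjoint w ** n) $ j $ j = 0" by (simp add: matrix_matrix_mult_def w orth)
      ultimately have 1: "(w ** (cadjoint w ** n)) $ r $ j = 0" for r by simp
      have "(n ** (cadjoint w ** w)) $ r $ j = (\<Sum>l\<in>UNIV. if l = j then n $ r $ j * S else 0)" for r
        unfolding matrix_matrix_mult_def[of n] vec_lambda_beta
        by (rule sum.cong) (auto simp: matrix_matrix_mult_def w S_def)
      then have 2: "(n ** (cadjoint w ** w)) $ r $ j = n $ r $ j * S" for r by simp
      have col: "n $ r $ j * S = \<zeta> * x r" for r
        using arg_cong[OF eq, of "\<lambda>A. A $ r $ j"] 1[of r] 2[of r] by (simp add: w matrix_mul_assoc)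
      \<comment> \<open>Pairing column j with x annihilates the left side and leaves
        \<open>\<zeta> * S\<close>. Hence \<zeta> vanishes, and row i of \<open>col\<close>
        contradicts the choice of i and j.\<close>
      have "(\<Sum>r\<in>UNIV. cnj (x r) * n $ r $ j) * S = (\<Sum>r\<in>UNIV. cnj (x r) * (n $ r $ j * S))"
        by (simp add: sum_distrib_right mult.assoc)
      also have "\<dots> = (\<Sum>r\<in>UNIV. cnj (x r) * (\<zeta> * x r))" by (simp only: col)
      also have "\<dots> = \<zeta> * S" by (simp add: S_def sum_distrib_left algebra_simps)
      finally have "(\<Sum>r\<in>UNIV. cnj (x r) * n $ r $ j) * S = \<zeta> * S" .
      then have "\<zeta> = 0" using S by (simp add: orth)
      then show False using col[of i] S ij by simp
    qed
  qed
qed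

theorem corollary1:
  fixes g :: "complex^2^'m::finite \<Rightarrow> complex^2^'m \<Rightarrow> complex^2^'m \<Rightarrow> real"
  assumes "CARD('m) \<ge> 3"
    and "invariant_metric g"
  shows "\<not> (\<exists>(M :: (complex^2^'m) set) N.
            real_hypersurface TYPE('k::finite) M \<and> connected M \<and> orientable TYPE('k) M \<and>
            unit_normal_field g M N \<and> F_invariant g M (shape_operator g M N))"
proof
  assume "\<exists>(M :: (complex^2^'m) set) N.
            real_hypersurface TYPE('k::finite) M \<and> connected M \<and> orientable TYPE('k) M \<and>
            unit_normal_field g M N \<and> F_invariant g M (shape_operator g M N)"
  then obtain M :: "(complex^2^'m) set" and N where
    hypersurface: "real_hypersurface TYPE('k) M" and normal_field: "unit_normal_field g M N"
    and F: "F_invariant g M (shape_operator g M N)" by blast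
  interpret hypersurface "TYPE('k)" grassmannian g bergman_christoffel M N
    by (rule hypersurface_bergman[OF assms(2) hypersurface normal_field])
  obtain c where c: "\<And>Z X Y. Z \<in> grassmannian \<Longrightarrow> g Z X Y = c * bergman Z X Y"
    using invariant_metric_eq_bergman[OF assms(2)] by blast
  have J: "kaehler_structure X = mat \<i> ** X" for X :: "complex^2^'m"
    by (simp add: kaehler_structure_def vec_eq_iff)
  have gJ: "g q (mat \<i> ** X) Y = - g q X (mat \<i> ** Y)" if "q \<in> M" for q X Y
    by (simp add: c in_\<Omega>[OF that] bergman_kaehler)
  \<comment> \<open>This is JN, the Reeb field up to sign, defined on all of M because N is. It is
    tangent and orthogonal to the maximal complex subbundle because J is skew for g.\<close>
  let ?\<xi> = "\<lambda>q. mat \<i> ** N q"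
  have \<xi>: "vector_field M M ?\<xi>"
  proof -
    have "smooth_within M ?\<xi>"
      by (rule smooth_within_bounded_linear[OF bounded_bilinear.bounded_linear_right[OF
              bounded_bilinear_matrix_mult] N_smooth])
    moreover have "g q (N q) (?\<xi> q) = 0" if "q \<in> M" for q
      using gJ[OF that, of "N q" "N q"] metric(2)[OF in_\<Omega>[OF that], of "N q" "?\<xi> q"] by simp
    ultimately show ?thesis by (simp add: vector_field_def tangent_iff)
  qed
  have umbilical: "\<exists>\<alpha>. \<forall>v\<in>tangent_space M p. shape_operator g M N p v = \<alpha> *\<^sub>R v" if p: "p \<in> M" for p
  proof -
    have "mat \<i> ** (mat \<i> ** N p) = - N p" by (simp add: vec_eq_iff)
    moreover have "N p \<noteq> 0" using N_unit[OF p] bilinear_lzero[OF metric(1)[OF in_\<Omega>[OF p]]] by force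
    ultimately have "?\<xi> p \<noteq> 0" by force
    moreover have "lie_derivative M (\<lambda>q. (1 + a \<bullet> (q - p)) *\<^sub>R ?\<xi> q) (shape_operator g M N) Y p = 0"
      if Y: "vector_field M M Y" for a Y
    proof -
      let ?X = "\<lambda>q. (1 + a \<bullet> (q - p)) *\<^sub>R ?\<xi> q"
      have X: "vector_field M M ?X" by (rule vector_field_scale[OF \<xi>])
      have "?X q \<in> orth_complement g M (max_complex M) q" if q: "q \<in> M" for q
      proof -
        have "g q (?X q) w = 0" if "w \<in> max_complex M q" for w
          using that N_normal[OF q, of "mat \<i> ** w"] gJ[OF q, of "N q" w]
          by (simp add: bilinear_lmul[OF metric(1)[OF in_\<Omega>[OF q]]] max_complex_def J)
        then show ?thesis using X q by (simp add: orth_complement_def vector_field_def)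
      qed
      then have "belongs_to_F g M M ?X" unfolding belongs_to_F_def by blast
      then show ?thesis using F X Y p openin_subtopology_self unfolding F_invariant_def by blast
    qed
    ultimately obtain \<alpha> where "\<And>v. v \<in> tangent_space M p \<Longrightarrow> shape_operator g M N p v = \<alpha> *\<^sub>R v"
      using umbilical_if_scale_invariant[OF p \<xi>] by blast
    then show ?thesis by blast
  qed
  obtain p where p: "p \<in> M" using hypersurface unfolding real_hypersurface_def by blast
  obtain h P Q P' Q' where "h \<in> SU2m" "act h 0 = p" "\<And>X. act_deriv h 0 X = P ** X ** Q"
    and PQ: "P' ** P = mat 1" "P ** P' = mat 1" "Q ** Q' = mat 1" "Q' ** Q = mat 1"
    "det (gram p) \<noteq> 0" and sharp: "\<And>X. sharp p (P ** X ** Q) = Q' ** cadjoint X ** P'"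
    using grassmannian_frame[OF in_\<Omega>[OF p]] by blast
  define n where "n = P' ** N p ** Q'"
  have "P ** n ** Q = (P ** P') ** N p ** (Q' ** Q)" by (simp only: n_def matrix_mul_assoc)
  then have Np: "N p = P ** n ** Q" by (simp add: PQ)
  have "n \<noteq> 0" using Np N_unit[OF p] bilinear_lzero[OF metric(1)[OF in_\<Omega>[OF p]]] by force
  moreover have "CARD('m) \<ge> 2" using assms(1) by simp
  ultimately obtain w where w: "w \<noteq> 0" "trace (cadjoint n ** w) = 0"
    "\<And>\<zeta>. w ** cadjoint w ** n + n ** cadjoint w ** w \<noteq> mat \<zeta> ** w"
    using curvature_not_proportional by blast
  define W where "W = P ** w ** Q"
  have normal: "g p (N p) (P ** X ** Q) = c * Re (trace (cadjoint n ** X))" for X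
    unfolding Np c[OF in_\<Omega>[OF p]] bergman_frame[OF PQ(1,3) sharp] ..
  have JW: "mat \<i> ** W = P ** (mat \<i> ** w) ** Q"
    by (simp add: W_def matrix_mul_assoc mat_mult_commute[of _ P])
  \<comment> \<open>The complex trace of \<open>cadjoint n ** w\<close> vanishes, not merely its
    real part; this makes both W and its multiple by \<i> tangent.\<close>
  have "cadjoint n ** (mat \<i> ** w) = mat \<i> ** (cadjoint n ** w)"
    by (simp only: mat_mult_commute) (simp only: matrix_mul_assoc)
  then have "trace (cadjoint n ** (mat \<i> ** w)) = \<i> * trace (cadjoint n ** w)"
    by (simp add: trace_def sum_distrib_left)
  then have W: "W \<in> tangent_space M p" "mat \<i> ** W \<in> tangent_space M p"
    unfolding tangent_iff[OF p] JW unfolding W_def normal by (simp_all add: w(2))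
  have unframe: "P' ** (P ** X ** Q) ** Q' = X" for X
  proof -
    have "P' ** (P ** X ** Q) ** Q' = (P' ** P) ** X ** (Q ** Q')" by (simp only: matrix_mul_assoc)
    then show ?thesis by (simp add: PQ)
  qed
  have JW0: "mat \<i> ** W \<noteq> 0"
  proof
    assume "mat \<i> ** W = 0"
    then have "P' ** (P ** (mat \<i> ** w) ** Q) ** Q' = 0" unfolding JW by simp
    then have "mat \<i> ** w = 0" unfolding unframe .
    then show False using w(1) by (simp add: vec_eq_iff)
  qed
  obtain a b where "(mat \<i> ** W) ** sharp p W ** N p + N p ** sharp p W ** (mat \<i> ** W)
      - W ** sharp p (mat \<i> ** W) ** N p - N p ** sharp p (mat \<i> ** W) ** W = a *\<^sub>R (mat \<i> ** W) + b *\<^sub>R W"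
  proof (rule umbilical_codazzi[OF umbilical bergman_christoffel_has_derivative
        bilinear_bergman_christoffel_deriv p W(2) JW0 W(1)])
    show "det (gram q) \<noteq> 0" if "q \<in> grassmannian" for q using grassmannian_frame[OF that] by metis
  qed (simp_all only: bergman_curvature that)
  moreover have "(mat \<i> ** W) ** sharp p W ** N p + N p ** sharp p W ** (mat \<i> ** W)
      - W ** sharp p (mat \<i> ** W) ** N p - N p ** sharp p (mat \<i> ** W) ** W
      = mat (2 * \<i>) ** (P ** (w ** cadjoint w ** n + n ** cadjoint w ** w) ** Q)"
  proof -
    have 1: "W ** sharp p W ** N p = P ** (w ** cadjoint w ** n) ** Q"
    proof -
      have "W ** sharp p W ** N p = P ** w ** (Q ** Q') ** cadjoint w ** (P' ** P) ** n ** Q"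
        unfolding W_def sharp Np by (simp only: matrix_mul_assoc)
      then show ?thesis by (simp add: PQ matrix_mul_assoc)
    qed
    have 2: "N p ** sharp p W ** W = P ** (n ** cadjoint w ** w) ** Q"
    proof -
      have "N p ** sharp p W ** W = P ** n ** (Q ** Q') ** cadjoint w ** (P' ** P) ** w ** Q"
        unfolding W_def sharp Np by (simp only: matrix_mul_assoc)
      then show ?thesis by (simp add: PQ matrix_mul_assoc)
    qed
    have 3: "(mat \<i> ** W) ** sharp p W ** N p = mat \<i> ** (W ** sharp p W ** N p)"
      by (simp add: matrix_mul_assoc)
    have 4: "N p ** sharp p W ** (mat \<i> ** W) = mat \<i> ** (N p ** sharp p W ** W)"
      by (simp only: mat_mult_commute) (simp only: matrix_mul_assoc)
    have 5: "W ** sharp p (mat \<i> ** W) ** N p = mat (- \<i>) ** (W ** sharp p W ** N p)"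
      by (simp add: sharp_mat matrix_mul_assoc mat_mult_commute[of "- \<i>" W])
    have 6: "N p ** sharp p (mat \<i> ** W) ** W = mat (- \<i>) ** (N p ** sharp p W ** W)"
      by (simp add: sharp_mat matrix_mul_assoc mat_mult_commute[of "- \<i>" "N p"])
    \<comment> \<open>Conjugate linearity of \<open>sharp\<close> has turned \<i> into
      \<open>- \<i>\<close> in the two subtracted terms, so the four terms add up with the factor
      \<open>2 * \<i>\<close>.\<close>
    have "mat \<i> ** X + mat \<i> ** Y - mat (- \<i>) ** X - mat (- \<i>) ** Y = mat (2 * \<i>) ** (X + Y)"
      for X Y :: "complex^2^'m" by (simp add: vec_eq_iff algebra_simps)
    then show ?thesis unfolding 3 4 5 6 1 2 by (simp only: matrix_mult_distribs)
  qed
  \<comment> \<open>The real combination is a complex multiple of W, written with the same factor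
    \<open>2 * \<i>\<close> and in the same frame as the curvature, so that both can be
    cancelled.\<close>
  moreover have "a *\<^sub>R (mat \<i> ** W) + b *\<^sub>R W = mat (2 * \<i>) ** (P ** (mat ((a * \<i> + b) / (2 * \<i>)) ** w) ** Q)"
  proof -
    have "P ** (mat z ** w) ** Q = mat z ** W" for z
      by (simp add: W_def matrix_mul_assoc mat_mult_commute[of _ P])
    then show ?thesis by (simp add: vec_eq_iff) (simp add: scaleR_conv_of_real field_simps)
  qed
  ultimately have eq: "mat (2 * \<i>) ** (P ** (w ** cadjoint w ** n + n ** cadjoint w ** w) ** Q)
      = mat (2 * \<i>) ** (P ** (mat ((a * \<i> + b) / (2 * \<i>)) ** w) ** Q)" by simp
  have "P ** (w ** cadjoint w ** n + n ** cadjoint w ** w) ** Q = P ** (mat ((a * \<i> + b) / (2 * \<i>)) ** w) ** Q"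
    using eq unfolding vec_eq_iff mat_mult_nth by simp
  then have "w ** cadjoint w ** n + n ** cadjoint w ** w = mat ((a * \<i> + b) / (2 * \<i>)) ** w"
    by (metis unframe)
  then show False using w(3) by blast
qed

end
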